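(* For any Janus thread $\gamma$, we have $\mathcal{K}(\gamma)=K(\gamma)$, where $K$ is the recursively defined bijection from Janus threads to peakless Motzkin paths and $\mathcal{K}$ is the directly defined map, both described in the context.
   Context: Permutations are written in one-line notation; $S_n$ is the set of permutations of $\{1,\dots,n\}$, $|\pi|$ is the length of $\pi$, and $1$ denotes the permutation of length one. For $\pi\in S_n$ the complement $c(\pi)\in S_n$ is $c(\pi)(j)=n+1-\pi(j)$. For $\pi\in S_n$, $\sigma\in S_m$: $\pi\oplus\sigma\in S_{n+m}$ has $(\pi\oplus\sigma)(j)=\pi(j)$ for $j\le n$ and $n+\sigma(j-n)$ for $j>n$; $\pi\ominus\sigma\in S_{n+m}$ has $(\pi\ominus\sigma)(j)=m+\pi(j)$ for $j\le n$ and $\sigma(j-n)$ for $j>n$. $\emptyset$ is the empty permutation (length $0$), an identity for $\oplus$ and $\ominus$. $@$ is a formal symbol, the "antipermutation", regarded as the unique permutation of length $-1$, with $c(@)=@$, $1\oplus @=@\oplus 1=1\ominus @=@\ominus 1=\emptyset$ and $\emptyset\ominus @=@\ominus\emptyset=@$; in an iterated sum each $@$ is combined with an adjacent $1$ first (so $1\oplus @\oplus 1=1$, $\sigma\ominus 1\ominus @=\sigma$, $@\ominus 1\ominus\sigma=\sigma$). The permutation induced by $\pi$ on a set of its entries is the standardization of the corresponding subsequence. A complete Baxter permutation is a permutation $\pi$ of length $2n+1$ such that $\pi(i)$ is even iff $i$ is even, and whenever $\pi(x)=i$, $\pi(y)=i+1$ and $z$ lies strictly between $x$ and $y$, then $\pi(z)<i$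 if $i$ is odd and $\pi(z)>i+1$ if $i$ is even. A permutation is alternating if it begins with an ascent and its ascents and descents alternate; it is doubly alternating if it and its inverse are alternating (permutations of length $\le 1$ are doubly alternating). A permutation $\sigma$ of length $n\ge 0$ is a snow leopard permutation if there is a complete Baxter permutation of length $2n+1$ whose even entries induce $\sigma$ and whose odd entries induce a doubly alternating permutation (of length $n+1$). By convention $@$ is also a snow leopard permutation; "odd length" includes length $-1$. Snow leopard permutations preserve parity ($\pi(j)$ is even iff $j$ is even). For a parity-preserving $\pi$, $\pi^e$ and $\pi^o$ are the permutations induced by $\pi$ on its even and odd entries; if $|\pi|=2n+1\ge 1$ then $|\pi^e|=n$, $|\pi^o|=n+1$. By convention $@^e=@$, $@^o=\emptyset$. An even thread (resp. odd thread) is a permutation of the form $\pi^e$ (resp. $\pi^o$) for some snow leopard permutation $\pi$ of odd length. A Janus thread is a permutation that is both an even thread and an odd thread; by convention $@$ is also a Janus thread (of length $-1$). $JT_n$ is the set of Janus threads of length $n$. Lattice paths are words in the steps $U=(1,1)$, $D=(1,-1)$, $L=(1,0)$. A Motzkin path of length $n$ is such a path from $(0,0)$ to $(n,0)$ not passing below the $x$-axis; it is peakless if no $U$ is immediately followed by a $D$. $UD_n$ is the set of peakless Motzkin paths of length $n$; $\emptyset$ also denotes the empty path. $K:JT_n\to UD_{n+1}$ ($n\ge -1$) are the unique bijections with $K(@)=\emptyset$, $K(\emptyset)=L$, $K(1\ominus\gamma_1)=L\,K(\gamma_1)$ for a Janus thread $\gamma_1$, and $K((1\oplus c(\gamma_1)\oplus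 1)\ominus 1\ominus\gamma_2)=U\,K(\gamma_1)\,D\,K(\gamma_2)$ for Janus threads $\gamma_1,\gamma_2$ with $|\gamma_1|\ge 0$. $\mathcal{K}$ is defined as follows: $\mathcal{K}(@)=\emptyset$, $\mathcal{K}(\emptyset)=L$. For a Janus thread $\gamma$ of length $n\ge 1$: (1) write the sequence $n+1,\gamma(1),\dots,\gamma(n),0$. (2) For each pair of consecutive entries of this sequence, write $L$ if they are consecutive integers (in either order); otherwise write $U$ if they form an ascent and $D$ if they form a descent. (3) In the resulting word of $n+1$ letters, number the subsequence of $U$s and $D$s from left to right starting with $1$, and change every odd-numbered $U$ to $D$ and every odd-numbered $D$ to $U$. The resulting word is $\mathcal{K}(\gamma)$. *)

theory Defs
  imports Main "HOL-Library.FuncSet"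
begin

text \<open>
  Permutations are written in one-line notation as lists of natural numbers.  The type
  \<open>aperm\<close> adjoins the antipermutation \<open>@\<close>, of length -1, to the
  permutations; \<open>Perm xs\<close> is meaningful when \<open>is_perm xs\<close>.
\<close>

definition is_perm :: "nat list \<Rightarrow> bool" where
  "is_perm p \<longleftrightarrow> distinct p \<and> set p = {1..length p}"

text \<open>One-based access: \<open>entry p j\<close> is $p(j)$ for $1 \le j \le |p|$.\<close>

definition entry :: "nat list \<Rightarrow> nat \<Rightarrow> nat" where
  "entry p j = p ! (j - 1)"

definition inv_perm :: "nat list \<Rightarrow> nat list" where
  "inv_perm p = map (\<lambda>v. THE j. j \<in> {1..length p} \<and> entry p j = v) [1..<length p + 1]"

definition standardize :: "nat list \<Rightarrow> nat list" where
  "standardize xs = map (\<lambda>x. card {y \<in> set xs. y \<le> x}) xs"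

definition induced :: "(nat \<Rightarrow> bool) \<Rightarrow> nat list \<Rightarrow> nat list" where
  "induced P p = standardize (filter P p)"

datatype aperm = Anti | Perm "nat list"

fun alength :: "aperm \<Rightarrow> int" where
  "alength Anti = -1"
| "alength (Perm p) = int (length p)"

abbreviation one_perm :: aperm where
  "one_perm \<equiv> Perm [1]"

abbreviation empty_perm :: aperm where
  "empty_perm \<equiv> Perm []"

fun complement :: "aperm \<Rightarrow> aperm" where
  "complement Anti = Anti"
| "complement (Perm p) = Perm (map (\<lambda>v. length p + 1 - v) p)"

text \<open>
  Sums involving \<open>@\<close> are defined only when the other summand is \<open>1\<close> or the empty
  permutation.  The operators associate to the right, so that in
  $\sigma \ominus 1 \ominus @$ the antipermutation is combined with the adjacent \<open>1\<close> first.
\<close>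

fun dsum :: "aperm \<Rightarrow> aperm \<Rightarrow> aperm"  (infixr "\<oplus>" 65) where
  "Perm p \<oplus> Perm q = Perm (p @ map (\<lambda>v. length p + v) q)"
| "Perm p \<oplus> Anti = (if p = [1] then empty_perm else if p = [] then Anti else undefined)"
| "Anti \<oplus> Perm q = (if q = [1] then empty_perm else if q = [] then Anti else undefined)"
| "Anti \<oplus> Anti = undefined"

fun ssum :: "aperm \<Rightarrow> aperm \<Rightarrow> aperm"  (infixr "\<ominus>" 65) where
  "Perm p \<ominus> Perm q = Perm (map (\<lambda>v. length q + v) p @ q)"
| "Perm p \<ominus> Anti = (if p = [1] then empty_perm else if p = [] then Anti else undefined)"
| "Anti \<ominus> Perm q = (if q = [1] then empty_perm else if q = [] then Anti else undefined)"
| "Anti \<ominus> Anti = undefined"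

definition complete_Baxter :: "nat list \<Rightarrow> bool" where
  "complete_Baxter p \<longleftrightarrow>
     is_perm p \<and> odd (length p) \<and>
     (\<forall>i\<in>{1..length p}. even (entry p i) \<longleftrightarrow> even i) \<and>
     (\<forall>x\<in>{1..length p}. \<forall>y\<in>{1..length p}. \<forall>z. \<forall>i.
        entry p x = i \<longrightarrow> entry p y = i + 1 \<longrightarrow> (x < z \<and> z < y \<or> y < z \<and> z < x) \<longrightarrow>
        (odd i \<longrightarrow> entry p z < i) \<and> (even i \<longrightarrow> entry p z > i + 1))"

definition alternating :: "nat list \<Rightarrow> bool" where
  "alternating p \<longleftrightarrow>
     (\<forall>j. 1 \<le> j \<and> j < length p \<longrightarrow>
        (odd j \<longrightarrow> entry p j < entry p (j + 1)) \<and>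
        (even j \<longrightarrow> entry p j > entry p (j + 1)))"

definition doubly_alternating :: "nat list \<Rightarrow> bool" where
  "doubly_alternating p \<longleftrightarrow> is_perm p \<and> alternating p \<and> alternating (inv_perm p)"

fun snow_leopard :: "aperm \<Rightarrow> bool" where
  "snow_leopard Anti = True"
| "snow_leopard (Perm s) =
     (\<exists>b. complete_Baxter b \<and> length b = 2 * length s + 1 \<and>
        induced even b = s \<and> doubly_alternating (induced odd b))"

fun even_part :: "aperm \<Rightarrow> aperm" where
  "even_part Anti = Anti"
| "even_part (Perm p) = Perm (induced even p)"

fun odd_part :: "aperm \<Rightarrow> aperm" where
  "odd_part Anti = empty_perm"
| "odd_part (Perm p) = Perm (induced odd p)"

definition even_threads :: "aperm set" where
  "even_threads = {even_part p | p. snow_leopard p \<and> odd (alength p)}"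

definition odd_threads :: "aperm set" where
  "odd_threads = {odd_part p | p. snow_leopard p \<and> odd (alength p)}"

definition Janus_threads :: "aperm set" where
  "Janus_threads = (even_threads \<inter> odd_threads) \<union> {Anti}"

definition JT :: "int \<Rightarrow> aperm set" where
  "JT n = {g \<in> Janus_threads. alength g = n}"

datatype step = U | D | L

fun rise :: "step \<Rightarrow> int" where
  "rise U = 1"
| "rise D = -1"
| "rise L = 0"

definition height :: "step list \<Rightarrow> int" where
  "height w = sum_list (map rise w)"

definition Motzkin_path :: "step list \<Rightarrow> bool" where
  "Motzkin_path w \<longleftrightarrow> height w = 0 \<and> (\<forall>k\<le>length w. 0 \<le> height (take k w))"

definition peakless :: "step list \<Rightarrow> bool" where
  "peakless w \<longleftrightarrow> (\<forall>i. Suc i < length w \<longrightarrow> \<not> (w ! i = U \<and> w ! Suc i = D))"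

definition UD :: "nat \<Rightarrow> step list set" where
  "UD n = {w. length w = n \<and> Motzkin_path w \<and> peakless w}"

text \<open>
  The conditions characterising the recursively defined bijections $JT_n \to UD_{n+1}$,
  collected into one function on all Janus threads; extensionality fixes the irrelevant
  values outside the Janus threads, so that the function is unique as a total function.
\<close>

definition is_recursive_K :: "(aperm \<Rightarrow> step list) \<Rightarrow> bool" where
  "is_recursive_K F \<longleftrightarrow>
     F \<in> extensional Janus_threads \<and>
     (\<forall>n\<ge>-1. bij_betw F (JT n) (UD (nat (n + 1)))) \<and>
     F Anti = [] \<and>
     F empty_perm = [L] \<and>
     (\<forall>g1\<in>Janus_threads. F (one_perm \<ominus> g1) = [L] @ F g1) \<and>
     (\<forall>g1\<in>Janus_threads. \<forall>g2\<in>Janus_threads. alength g1 \<ge> 0 \<longrightarrow>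
        F ((one_perm \<oplus> complement g1 \<oplus> one_perm) \<ominus> one_perm \<ominus> g2)
          = [U] @ F g1 @ [D] @ F g2)"

definition recursive_K :: "aperm \<Rightarrow> step list" where
  "recursive_K = (THE F. is_recursive_K F)"

definition step_between :: "nat \<Rightarrow> nat \<Rightarrow> step" where
  "step_between a b = (if b = a + 1 \<or> a = b + 1 then L else if a < b then U else D)"

fun consecutive_steps :: "nat list \<Rightarrow> step list" where
  "consecutive_steps (a # b # xs) = step_between a b # consecutive_steps (b # xs)"
| "consecutive_steps _ = []"

text \<open>
  In \<open>swap_odd k w\<close>, the first letter of \<open>w\<close> other than \<open>L\<close> carries the number \<open>k\<close>.
\<close>

fun swap_odd :: "nat \<Rightarrow> step list \<Rightarrow> step list" where
  "swap_odd k [] = []"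
| "swap_odd k (L # w) = L # swap_odd k w"
| "swap_odd k (U # w) = (if odd k then D else U) # swap_odd (k + 1) w"
| "swap_odd k (D # w) = (if odd k then U else D) # swap_odd (k + 1) w"

fun direct_K :: "aperm \<Rightarrow> step list" where
  "direct_K Anti = []"
| "direct_K (Perm p) =
     (if p = [] then [L]
      else swap_odd 1 (consecutive_steps ((length p + 1) # p @ [0])))"

end

theory Submission
  imports Defs
begin


text \<open>
  The even and the odd threads are generated together: a snow leopard permutation
  of odd length other than $@$ is $(1 \oplus c(\pi_1) \oplus 1) \ominus 1 \ominus \pi_2$
  with $\pi_1, \pi_2$ again of this kind, so its even part is
  $c(\pi_1^o) \ominus 1 \ominus \pi_2^e$ and its odd part is
  $(1 \oplus c(\pi_1^e) \oplus 1) \ominus \pi_2^o$.  A permutation that has both forms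
  is forced to be $1 \ominus \gamma_1$ or
  $(1 \oplus c(\gamma_1) \oplus 1) \ominus 1 \ominus \gamma_2$ with Janus threads
  $\gamma_1, \gamma_2$, and all of these are Janus threads (\<open>Janus_threads_eq\<close>).
  Hence the two clauses of the recursion reach every Janus thread, and any two functions
  that satisfy it agree.

  It remains that the direct map satisfies the recursion and is a bijection.  In
  $(1 \oplus c(\gamma_1) \oplus 1) \ominus 1 \ominus \gamma_2$ the bounded word
  $|\gamma_1| + 1, \gamma_1, 0$ occurs upside down, between two long descents.  The first
  descent becomes $U$ and shifts the numbering of the letters inside by one, which undoes
  the reflection; the letters inside other than $L$ are even in number because they belong to a
  Motzkin path, so the second descent stays $D$ and the next letter has an odd number again
  (\<open>direct_K_hook\<close>).  Bijectivity is the first-return decomposition of peakless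
  Motzkin paths.

  The substance is the decomposition of snow leopard permutations
  (\<open>snow_box_shape\<close>).  In a complete Baxter permutation an even entry separates
  the entries near it like the hub of a windmill: on one side everything up to the next smaller value
  lies below it, on the other side everything up to the next larger value lies above it.
  Double alternation says that the two orientations alternate both along the positions and
  along the values.  Let $u$ be the first value, and suppose that $u$ is not the least.
  The hub with value $u - 1$ has only larger entries to its left.  Counting the hubs above it
  by orientation, once by their values and once by their positions, leaves no room for a larger
  entry to its right (\<open>cut_at_predecessor\<close>).  So the
  permutation splits at this hub as $\sigma \ominus 1 \ominus \tau$, where $\sigma$ starts
  with its least value; by symmetry $\sigma$ ends with its greatest value, and inside
  remains the complement of a smaller permutation of the same kind.
\<close>

section \<open>Windmills around the even entries\<close>

text \<open>
  The condition that the Baxter property and one choice of orientation impose on an even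
  entry at position \<open>p\<close>: the next smaller value is to its left, the next larger one to its right,
  and the entries in between lie below and above it respectively.  For \<open>falling\<close> left and
  right are exchanged.
\<close>

definition rising :: "int set \<Rightarrow> (int \<Rightarrow> int) \<Rightarrow> int \<Rightarrow> bool" where
  "rising I f p \<longleftrightarrow>
     (\<exists>q\<in>I. q < p \<and> f q = f p - 1 \<and> (\<forall>z. q < z \<and> z < p \<longrightarrow> f z < f p)) \<and>
     (\<exists>q\<in>I. p < q \<and> f q = f p + 1 \<and> (\<forall>z. p < z \<and> z < q \<longrightarrow> f p < f z))"

definition falling :: "int set \<Rightarrow> (int \<Rightarrow> int) \<Rightarrow> int \<Rightarrow> bool" where
  "falling I f p \<longleftrightarrow>
     (\<exists>q\<in>I. p < q \<and> f q = f p - 1 \<and> (\<forall>z. p < z \<and> z < q \<longrightarrow> f z < f p)) \<and>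
     (\<exists>q\<in>I. q < p \<and> f q = f p + 1 \<and> (\<forall>z. q < z \<and> z < p \<longrightarrow> f p < f z))"

text \<open>
  Residues modulo 4 record the alternation: the even position \<open>2 * j\<close> is the gap between the
  odd entries number \<open>j\<close> and \<open>j + 1\<close>, which ascend exactly if \<open>j\<close> is odd.  The same holds for
  values, hence position and value of an even entry agree modulo 4.
\<close>
definition windmill :: "int set \<Rightarrow> (int \<Rightarrow> int) \<Rightarrow> int \<Rightarrow> bool" where
  "windmill I f p \<longleftrightarrow>
     (even (f p) \<longleftrightarrow> even p) \<and>
     (even p \<longrightarrow> f p mod 4 = p mod 4) \<and>
     (p mod 4 = 2 \<longrightarrow> rising I f p) \<and> (p mod 4 = 0 \<longrightarrow> falling I f p)"

text \<open>
  A box of \<open>n\<close> positions after \<open>i\<close> and \<open>n\<close> values after \<open>v\<close>.  Blocks of a permutation are again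
  boxes of the same function, without any renumbering, because positions and values keep
  their residues.
\<close>
definition snow_box :: "int \<Rightarrow> int \<Rightarrow> int \<Rightarrow> (int \<Rightarrow> int) \<Rightarrow> bool" where
  "snow_box i v n f \<longleftrightarrow>
     bij_betw f {i<..i+n} {v<..v+n} \<and> (\<forall>p\<in>{i<..i+n}. windmill {i<..i+n} f p)"

lemma risingE:
  assumes "rising I f p"
  obtains q s where "q \<in> I" "q < p" "f q = f p - 1" "\<And>z. q < z \<Longrightarrow> z < p \<Longrightarrow> f z < f p"
    "s \<in> I" "p < s" "f s = f p + 1" "\<And>z. p < z \<Longrightarrow> z < s \<Longrightarrow> f p < f z"
proof -
  obtain q where "q \<in> I" "q < p" "f q = f p - 1" "\<forall>z. q < z \<and> z < p \<longrightarrow> f z < f p"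
    using assms unfolding rising_def by blast
  moreover obtain s where "s \<in> I" "p < s" "f s = f p + 1" "\<forall>z. p < z \<and> z < s \<longrightarrow> f p < f z"
    using assms unfolding rising_def by blast
  ultimately show ?thesis by (intro that[of q s]) auto
qed

lemma fallingE:
  assumes "falling I f p"
  obtains q s where "q \<in> I" "p < q" "f q = f p - 1" "\<And>z. p < z \<Longrightarrow> z < q \<Longrightarrow> f z < f p"
    "s \<in> I" "s < p" "f s = f p + 1" "\<And>z. s < z \<Longrightarrow> z < p \<Longrightarrow> f p < f z"
proof -
  obtain q where "q \<in> I" "p < q" "f q = f p - 1" "\<forall>z. p < z \<and> z < q \<longrightarrow> f z < f p"
    using assms unfolding falling_def by blast
  moreover obtain s where "s \<in> I" "s < p" "f s = f p + 1" "\<forall>z. s < z \<and> z < p \<longrightarrow> f p < f z"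
    using assms unfolding falling_def by blast
  ultimately show ?thesis by (intro that[of q s]) auto
qed

lemma risingI:
  assumes "q \<in> I" "q < p" "f q = f p - 1" "\<And>z. q < z \<Longrightarrow> z < p \<Longrightarrow> f z < f p"
    "s \<in> I" "p < s" "f s = f p + 1" "\<And>z. p < z \<Longrightarrow> z < s \<Longrightarrow> f p < f z"
  shows "rising I f p"
  unfolding rising_def using assms by blast

lemma fallingI:
  assumes "q \<in> I" "p < q" "f q = f p - 1" "\<And>z. p < z \<Longrightarrow> z < q \<Longrightarrow> f z < f p"
    "s \<in> I" "s < p" "f s = f p + 1" "\<And>z. s < z \<Longrightarrow> z < p \<Longrightarrow> f p < f z"
  shows "falling I f p"
  unfolding falling_def using assms by blast

lemma rising_neighbours:
  assumes "rising I f p" shows "f (p - 1) < f p" "f p < f (p + 1)"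
proof -
  obtain q where q: "q < p" "f q = f p - 1" "\<And>z. q < z \<and> z < p \<longrightarrow> f z < f p"
    using assms unfolding rising_def by blast
  show "f (p - 1) < f p" using q(1,2) q(3)[of "p - 1"] by (cases "q = p - 1") auto
  obtain r where r: "p < r" "f r = f p + 1" "\<And>z. p < z \<and> z < r \<longrightarrow> f p < f z"
    using assms unfolding rising_def by blast
  show "f p < f (p + 1)" using r(1,2) r(3)[of "p + 1"] by (cases "r = p + 1") auto
qed

lemma falling_neighbours:
  assumes "falling I f p" shows "f (p - 1) > f p" "f p > f (p + 1)"
proof -
  obtain q where q: "p < q" "f q = f p - 1" "\<And>z. p < z \<and> z < q \<longrightarrow> f z < f p"
    using assms unfolding falling_def by blast
  show "f p > f (p + 1)" using q(1,2) q(3)[of "p + 1"] by (cases "q = p + 1") auto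
  obtain r where r: "r < p" "f r = f p + 1" "\<And>z. r < z \<and> z < p \<longrightarrow> f p < f z"
    using assms unfolding falling_def by blast
  show "f (p - 1) > f p" using r(1,2) r(3)[of "p - 1"] by (cases "r = p - 1") auto
qed

lemma even_mod_4: "even (p::int) \<longleftrightarrow> p mod 4 = 0 \<or> p mod 4 = 2"
  by presburger

lemma windmill_even: "windmill I f p \<Longrightarrow> even p \<Longrightarrow> rising I f p \<or> falling I f p"
  unfolding windmill_def even_mod_4 by blast

lemma snow_box_inj:
  assumes "snow_box i v n f" "x \<in> {i<..i+n}" "y \<in> {i<..i+n}" "f x = f y" shows "x = y"
  using assms unfolding snow_box_def bij_betw_def inj_on_def by blast

lemma snow_box_in:
  assumes "snow_box i v n f" "x \<in> {i<..i+n}" shows "f x \<in> {v<..v+n}"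
  using assms unfolding snow_box_def bij_betw_def by blast

lemma snow_box_onto:
  assumes "snow_box i v n f" "w \<in> {v<..v+n}" obtains x where "x \<in> {i<..i+n}" "f x = w"
proof -
  have "w \<in> f ` {i<..i+n}" using assms unfolding snow_box_def bij_betw_def by simp
  then show ?thesis using that by blast
qed

lemma snow_box_windmill:
  assumes "snow_box i v n f" "x \<in> {i<..i+n}" shows "windmill {i<..i+n} f x"
  using assms unfolding snow_box_def by blast

text \<open>
  By injectivity the entries promised by \<open>rising\<close> and \<open>falling\<close> are the only ones with their
  values, so the two orientations can be treated alike.
\<close>
lemma between_arm:
  assumes box: "snow_box i v n f" and x: "x \<in> {i<..i+n}" and y: "y \<in> {i<..i+n}"
    and "even x" and z: "x < z \<and> z < y \<or> y < z \<and> z < x"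
  shows "f y = f x - 1 \<Longrightarrow> f z < f x" "f y = f x + 1 \<Longrightarrow> f x < f z"
proof -
  have *: "rising {i<..i+n} f x \<or> falling {i<..i+n} f x"
    using windmill_even[OF snow_box_windmill[OF box x] \<open>even x\<close>] .
  obtain q r where q: "q \<in> {i<..i+n}" "f q = f x - 1"
      "\<And>z. x < z \<and> z < q \<or> q < z \<and> z < x \<Longrightarrow> f z < f x"
    and r: "r \<in> {i<..i+n}" "f r = f x + 1"
      "\<And>z. x < z \<and> z < r \<or> r < z \<and> z < x \<Longrightarrow> f x < f z"
    using *
  proof
    assume "rising {i<..i+n} f x"
    then show ?thesis by (elim risingE) (rule that; auto)
  next
    assume "falling {i<..i+n} f x"
    then show ?thesis by (elim fallingE) (rule that; auto)
  qed
  show "f z < f x" if "f y = f x - 1"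
    using snow_box_inj[OF box y q(1)] that q(2,3) z by auto
  show "f x < f z" if "f y = f x + 1"
    using snow_box_inj[OF box y r(1)] that r(2,3) z by auto
qed

lemma last_crossing:
  fixes a b :: int
  assumes "a \<le> b" "R a" "\<not> R b"
  shows "\<exists>w. a \<le> w \<and> w < b \<and> R w \<and> \<not> R (w + 1)"
proof (rule ccontr)
  assume no: "\<not> ?thesis"
  have "c \<le> b \<longrightarrow> R c" if "a \<le> c" for c
    using that
  proof (induction c rule: int_ge_induct)
    case base then show ?case using assms by simp
  next
    case (step c) then show ?case using no by force
  qed
  then show False using assms by blast
qed

text \<open>
  This is the windmill condition with positions and values exchanged: the Baxter property
  passes to the inverse permutation.  If some value between those at \<open>x\<close> and \<open>x + 1\<close> lay to the left, then on the
  way from the value next to \<open>f x\<close>, which lies to the right, two consecutive values would lie on different sides of \<open>x\<close>.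
  One of the two is even, and its windmill has \<open>x\<close> or \<open>x + 1\<close> on the wrong level.
\<close>
lemma value_between_lies_right:
  assumes box: "snow_box i v n f" and x: "x \<in> {i<..i+n}" and x1: "x + 1 \<in> {i<..i+n}"
    and "even x" and y: "y \<in> {i<..i+n}"
    and btw: "f x < f y \<and> f y < f (x + 1) \<or> f (x + 1) < f y \<and> f y < f x"
  shows "x < y"
proof (rule ccontr)
  assume "\<not> x < y"
  with btw have yx: "y < x" by (cases "x = y") auto
  have inj: "x = y" if "x \<in> {i<..i+n}" "y \<in> {i<..i+n}" "f x = f y" for x y
    using snow_box_inj[OF box that] .
  define R where "R w \<longleftrightarrow> (\<exists>q\<in>{i<..i+n}. f q = w \<and> x < q)" for w
  have Ry: "\<not> R (f y)" unfolding R_def using inj[OF _ y] yx by fastforce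
  have wm: "windmill {i<..i+n} f p" if "p \<in> {i<..i+n}" for p
    using snow_box_windmill[OF box that] .
  have left: "\<exists>q\<in>{i<..i+n}. f q = w \<and> q < x" if "\<not> R w" "v < w" "w \<le> v+n" "w \<noteq> f x" for w
  proof -
    have "w \<in> {v<..v+n}" using that by simp
    then obtain q where "q \<in> {i<..i+n}" "f q = w" by (rule snow_box_onto[OF box])
    then show ?thesis using that unfolding R_def by (metis linorder_neqE_linordered_idom)
  qed
  note rng = snow_box_in[OF box x] snow_box_in[OF box x1] snow_box_in[OF box y]
  show False
  proof (cases "f x < f y")
    case True
    have up: "rising {i<..i+n} f x"
      using windmill_even[OF wm[OF x] \<open>even x\<close>] falling_neighbours(2)[of _ f x] btw True by force
    then have "R (f x + 1)" unfolding rising_def R_def by blast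
    then obtain w where w: "f x + 1 \<le> w" "w < f y" "R w" "\<not> R (w + 1)"
      using last_crossing[of "f x + 1" "f y" R] Ry True by auto
    obtain q where q: "q \<in> {i<..i+n}" "f q = w" "x < q" using w(3) R_def by blast
    obtain r where r: "r \<in> {i<..i+n}" "f r = w + 1" "r < x"
      using left[of "w+1"] w rng by force
    show False
    proof (cases "even q")
      case True
      then show False using between_arm(2)[OF box q(1) r(1), of x] q r w by auto
    next
      case False
      then have "even r" using wm[OF q(1)] wm[OF r(1)] q(2) r(2) unfolding windmill_def by simp
      moreover have "q \<noteq> x + 1" using q(2) w btw True by auto
      ultimately show False using between_arm(1)[OF box r(1) q(1), of "x + 1"] q r w btw True by auto
    qed
  next
    case False
    have dn: "falling {i<..i+n} f x"
      using windmill_even[OF wm[OF x] \<open>even x\<close>] rising_neighbours(2)[of _ f x] btw False by force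
    then have "R (f x - 1)" unfolding falling_def R_def by blast
    then obtain w where w: "f y \<le> w" "w < f x - 1" "\<not> R w" "R (w + 1)"
      using last_crossing[of "f y" "f x - 1" "\<lambda>w. \<not> R w"] Ry False btw by auto
    obtain q where q: "q \<in> {i<..i+n}" "f q = w + 1" "x < q" using w(4) R_def by blast
    obtain r where r: "r \<in> {i<..i+n}" "f r = w" "r < x"
      using left[of w] w rng by force
    show False
    proof (cases "even q")
      case True
      then show False using between_arm(1)[OF box q(1) r(1), of x] q r w by auto
    next
      case False
      then have "even r" using wm[OF q(1)] wm[OF r(1)] q(2) r(2) unfolding windmill_def by simp
      moreover have "q \<noteq> x + 1" using q(2) w btw by auto
      ultimately show False using between_arm(2)[OF box r(1) q(1), of "x + 1"] q r w btw \<open>\<not> f x < f y\<close> by auto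
    qed
  qed
qed

section \<open>The cut below the first value\<close>

text \<open>
  Let \<open>c\<close> be the value just below the first one.  To the right of \<open>P\<close> an even entry exceeds \<open>c\<close>
  exactly if its right neighbour does.  Among the even values from \<open>c\<close> on, the two residues
  modulo 4 are equally frequent, since \<open>w \<mapsto> w + 2\<close> matches them.  Among their positions,
  \<open>x \<mapsto> x - 2\<close> maps the residue 0 injectively into the residue 2, so it is onto: every even
  entry from \<open>c\<close> on at a position of residue 2 is followed by another one two positions later.
  Then there is no last entry above \<open>c\<close> to the right of \<open>P\<close>.
\<close>

lemma cut_at_predecessor:
  assumes box: "snow_box i v n f" and i: "i mod 4 = 0" and v: "v mod 4 = 0" and n: "n mod 4 = 3"
    and P: "P \<in> {i<..i+n}" and fP: "f P = f (i + 1) - 1"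
  shows "P mod 4 = 0" "\<And>z. z \<in> {i<..i+n} \<Longrightarrow> z < P \<Longrightarrow> f P < f z"
    "\<And>z. z \<in> {i<..i+n} \<Longrightarrow> P < z \<Longrightarrow> f z < f P"
proof -
  let ?B = "{i<..i+n}"
  have i1: "i + 1 \<in> ?B" using P by auto
  have wm: "windmill ?B f p" if "p \<in> ?B" for p using snow_box_windmill[OF box that] .
  have inj: "x = y" if "x \<in> ?B" "y \<in> ?B" "f x = f y" for x y using snow_box_inj[OF box that] .
  have "odd (i + 1)" using i by presburger
  then have evP: "even P" using wm[OF P] wm[OF i1] fP unfolding windmill_def by simp
  have Pi: "i + 1 < P" using P fP by (cases "P = i + 1") auto
  have "\<not> rising ?B f P"
  proof
    assume "rising ?B f P"
    then obtain q where "q \<in> ?B" "P < q" "f q = f P + 1" unfolding rising_def by blast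
    then show False using inj[of q "i + 1"] i1 fP Pi by auto
  qed
  then have P0: "P mod 4 = 0" and fall: "falling ?B f P"
    using wm[OF P] evP unfolding windmill_def even_mod_4 by auto
  then show "P mod 4 = 0" by simp
  have fP4: "f P mod 4 = 0" using wm[OF P] evP P0 unfolding windmill_def by simp
  show left: "f P < f z" if "z \<in> ?B" "z < P" for z
    using between_arm(2)[OF box P i1 evP, of z] that fP by (cases "z = i + 1") auto
  \<comment> \<open>otherwise \<open>f P\<close> lies between two adjacent values and hence to the right of \<open>x\<close>\<close>
  have hi_iff: "f P < f x \<longleftrightarrow> f P < f (x + 1)" if x: "x \<in> ?B" "x + 1 \<in> ?B" "even x" "P < x" for x
  proof -
    have "f x \<noteq> f P" "f (x + 1) \<noteq> f P" using inj[OF x(1) P] inj[OF x(2) P] x(4) by auto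
    then show ?thesis using value_between_lies_right[OF box x(1,2,3) P] x(4) by linarith
  qed
  define Q where "Q r = {x\<in>?B. x mod 4 = r \<and> f P \<le> f x}" for r
  define V where "V r = {w\<in>{v<..v+n}. w mod 4 = r \<and> f P \<le> w}" for r
  \<comment> \<open>\<open>Q r\<close> and \<open>V r\<close> are the positions and the values of the even entries from \<open>f P\<close> on with residue \<open>r\<close>\<close>
  have QV: "bij_betw f (Q r) (V r)" if "even r" for r
  proof (rule bij_betwI')
    show "f x = f y \<longleftrightarrow> x = y" if "x \<in> Q r" "y \<in> Q r" for x y using that inj unfolding Q_def by auto
    show "f x \<in> V r" if "x \<in> Q r" for x
    proof -
      have "even x" using that \<open>even r\<close> unfolding Q_def by (auto simp: even_mod_4)
      then show ?thesis using that wm[of x] snow_box_in[OF box, of x] unfolding Q_def V_def windmill_def by auto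
    qed
    show "\<exists>x\<in>Q r. w = f x" if "w \<in> V r" for w
    proof -
      obtain x where x: "x \<in> ?B" "f x = w" using snow_box_onto[OF box, of w] \<open>w \<in> V r\<close> V_def by auto
      have "even w" using that \<open>even r\<close> unfolding V_def by (auto simp: even_mod_4)
      then have "even x" "x mod 4 = w mod 4" using wm[OF x(1)] x(2) unfolding windmill_def by auto
      then show ?thesis using x that unfolding Q_def V_def by auto
    qed
  qed
  have "bij_betw (\<lambda>w. w + 2) (V 0) (V 2)"
  proof (rule bij_betwI[where g = "\<lambda>w. w - 2"])
    show "(\<lambda>w. w + 2) \<in> V 0 \<rightarrow> V 2"
    proof
      fix w assume "w \<in> V 0"
      then show "w + 2 \<in> V 2" unfolding V_def using v n by auto presburger+
    qed
    show "(\<lambda>w. w - 2) \<in> V 2 \<rightarrow> V 0"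
    proof
      fix w assume w: "w \<in> V 2"
      then have "f P \<le> w - 2" unfolding V_def using fP4 by auto presburger
      then show "w - 2 \<in> V 0" using w snow_box_in[OF box P] unfolding V_def by auto presburger+
    qed
  qed auto
  then have "card (V 0) = card (V 2)" by (rule bij_betw_same_card)
  then have card: "card (Q 0) = card (Q 2)"
    using bij_betw_same_card[OF QV[of 0]] bij_betw_same_card[OF QV[of 2]] by simp
  have fin: "finite (Q r)" for r
    by (rule finite_subset[of _ ?B]) (auto simp: Q_def)
  have sub: "(\<lambda>x. x - 2) ` Q 0 \<subseteq> Q 2"
  proof
    fix y assume "y \<in> (\<lambda>x. x - 2) ` Q 0"
    then obtain x where xQ: "x \<in> Q 0" "y = x - 2" by blast
    then have x: "x \<in> ?B" "x mod 4 = 0" "f P \<le> f x" "y = x - 2" unfolding Q_def by simp_all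
    have yB: "y \<in> ?B" using x i by auto presburger
    have y4: "y mod 4 = 2" using x by presburger
    have "f P < f y"
    proof (cases "P < y")
      case True
      have "falling ?B f x" using wm[OF x(1)] x(2) unfolding windmill_def by auto
      then have "f P < f (y + 1)" using falling_neighbours(1)[of ?B f x] x by simp
      moreover have "y + 1 \<in> ?B" using x(1,4) yB by auto
      ultimately show ?thesis using hi_iff[OF yB _ _ True] y4 by presburger
    next
      case False
      then have "y < P" using y4 P0 by (cases "y = P") auto
      then show ?thesis using left[OF yB] by simp
    qed
    then show "y \<in> Q 2" using yB y4 unfolding Q_def by simp
  qed
  have "card ((\<lambda>x. x - 2) ` Q 0) = card (Q 0)" by (intro card_image inj_onI) simp
  then have "(\<lambda>x. x - 2) ` Q 0 = Q 2" using card_subset_eq[OF fin sub] card by simp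
  then have next_in: "x + 2 \<in> Q 0" if "x \<in> Q 2" for x using that by (force simp: image_iff)
  show "f z < f P" if z: "z \<in> ?B" "P < z" for z
  proof (rule ccontr)
    assume "\<not> f z < f P"
    define H where "H = {z\<in>?B. P < z \<and> f P < f z}"
    have "f z \<noteq> f P" using inj[OF z(1) P] z by auto
    then have "z \<in> H" using z \<open>\<not> f z < f P\<close> unfolding H_def by auto
    moreover have finH: "finite H"
      by (rule finite_subset[of _ ?B]) (auto simp: H_def)
    ultimately have "Max H \<in> H" using Max_in[of H] by blast
    \<comment> \<open>the last high entry to the right of \<open>P\<close>; each residue of \<open>m\<close> yields a later one\<close>
    define m where "m = Max H"
    have m: "m \<in> ?B" "P < m" "f P < f m" using \<open>Max H \<in> H\<close> unfolding H_def m_def by auto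
    have max: "False" if "y \<in> ?B" "m < y" "f P < f y" for y
      using Max_ge[OF finH, of y] that m unfolding H_def m_def by auto
    have step: False if y: "y \<in> Q 2" "P < y" "y + 2 > m" for y
    proof -
      have "y + 2 \<in> Q 0" using next_in y by simp
      moreover have "f (y + 2) \<noteq> f P" using inj[of "y+2" P] \<open>y + 2 \<in> Q 0\<close> P y unfolding Q_def by auto
      ultimately show False using max[of "y + 2"] y unfolding Q_def by auto
    qed
    have end4: "(i + n) mod 4 = 3" using i n by presburger
    consider "m mod 4 = 0" | "m mod 4 = 1" | "m mod 4 = 2" | "m mod 4 = 3"
      using pos_mod_bound[of 4 m] pos_mod_sign[of 4 m] by linarith
    then show False
    proof cases
      case 1
      then have "m + 1 \<in> ?B" "even m" using m(1) end4 by auto presburger+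
      then show False using hi_iff[OF m(1) _ _ m(2)] m max[of "m + 1"] by simp
    next
      case 2
      then have m1: "m + 1 \<in> ?B" "(m + 1) mod 4 = 2" using m(1) end4 by auto presburger+
      then have "rising ?B f (m + 1)" using wm[OF m1(1)] unfolding windmill_def by auto
      then show False using rising_neighbours(1)[of ?B f "m + 1"] m m1 max[of "m + 1"] by simp
    next
      case 3
      then show False using step[of m] m unfolding Q_def by simp
    next
      case 4
      have m1: "P < m - 1" "(m - 1) mod 4 = 2" "even (m - 1)" using m(2) P0 4 by presburger+
      then have "m - 1 \<in> ?B" using m(1) P by auto
      then have "f P < f (m - 1)" using hi_iff[of "m - 1"] m m1 by simp
      then show False using step[of "m - 1"] m1 \<open>m - 1 \<in> ?B\<close> unfolding Q_def by simp
    qed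
  qed
qed


section \<open>Moving and restricting boxes\<close>

lemma windmill_mono: "windmill I f p \<Longrightarrow> I \<subseteq> J \<Longrightarrow> windmill J f p"
  unfolding windmill_def rising_def falling_def by (meson subset_iff)

lemma windmill_cong:
  assumes "windmill I f p" "p \<in> {a<..b}" "I \<subseteq> {a<..b}" "\<And>x. x \<in> {a<..b} \<Longrightarrow> f x = g x"
  shows "windmill I g p"
proof -
  have *: "f x = g x" if "a < x" "x \<le> b" for x using assms(4) that by simp
  have I: "a < q" "q \<le> b" if "q \<in> I" for q using assms(3) that by auto
  have p: "f p = g p" "a < p" "p \<le> b" using assms(2,4) by auto
  have r: "rising I g p" if "rising I f p"
  proof -
    from that obtain q s where qs: "q \<in> I" "q < p" "f q = f p - 1" "\<And>z. q < z \<Longrightarrow> z < p \<Longrightarrow> f z < f p"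
      "s \<in> I" "p < s" "f s = f p + 1" "\<And>z. p < z \<Longrightarrow> z < s \<Longrightarrow> f p < f z"
      by (rule risingE) blast
    have "f z = g z" if "q \<le> z" "z \<le> s" for z using * I(1)[OF qs(1)] I(2)[OF qs(5)] that by auto
    then show ?thesis using qs by (intro risingI[of q _ _ _ s]) auto
  qed
  have f: "falling I g p" if "falling I f p"
  proof -
    from that obtain q s where qs: "q \<in> I" "p < q" "f q = f p - 1" "\<And>z. p < z \<Longrightarrow> z < q \<Longrightarrow> f z < f p"
      "s \<in> I" "s < p" "f s = f p + 1" "\<And>z. s < z \<Longrightarrow> z < p \<Longrightarrow> f p < f z"
      by (rule fallingE) blast
    have "f z = g z" if "s \<le> z" "z \<le> q" for z using * I(2)[OF qs(1)] I(1)[OF qs(5)] that by auto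
    then show ?thesis using qs by (intro fallingI[of q _ _ _ s]) auto
  qed
  show ?thesis using assms(1) r f unfolding windmill_def p(1) by simp
qed

lemma snow_box_cong:
  assumes "snow_box i v n f" "\<And>x. x \<in> {i<..i+n} \<Longrightarrow> f x = g x"
  shows "snow_box i v n g"
  unfolding snow_box_def
proof
  show "bij_betw g {i<..i+n} {v<..v+n}"
    using assms bij_betw_cong[of "{i<..i+n}" f g] unfolding snow_box_def by simp
  show "\<forall>p\<in>{i<..i + n}. windmill {i<..i + n} g p"
    using assms windmill_cong[of "{i<..i+n}" f _ i "i + n" g] unfolding snow_box_def by simp
qed

lemma snow_box_empty: "n \<le> 0 \<Longrightarrow> snow_box i v n f"
  unfolding snow_box_def by (simp add: bij_betw_def)

text \<open>
  With \<open>v'\<close> even and \<open>v' + n'\<close> odd, both neighbours of an even value of the smaller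
  box are again values of it, so no windmill loses an arm.
\<close>
lemma snow_box_restrict:
  assumes box: "snow_box i v n f" and sub: "i \<le> i'" "i' + n' \<le> i + n"
    and par: "even v'" "odd (v' + n')"
    and bij: "bij_betw f {i'<..i'+n'} {v'<..v'+n'}"
  shows "snow_box i' v' n' f"
  unfolding snow_box_def
proof (intro conjI bij ballI)
  fix p assume p: "p \<in> {i'<..i'+n'}"
  let ?B = "{i<..i+n}" and ?B' = "{i'<..i'+n'}"
  have subB: "?B' \<subseteq> ?B" using sub by auto
  then have wm: "windmill ?B f p" using box p unfolding snow_box_def by blast
  have fp: "f p \<in> {v'<..v'+n'}" using bij p unfolding bij_betw_def by blast
  have inside: "q \<in> ?B'" if "q \<in> ?B" "f q \<in> {v'<..v'+n'}" for q
  proof -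
    have "f q \<in> f ` ?B'" using bij that unfolding bij_betw_def by simp
    then obtain x where "x \<in> ?B'" "f x = f q" by (metis imageE)
    then show ?thesis using snow_box_inj[OF box, of x q] subB that by auto
  qed
  have near: "q \<in> ?B'" if "q \<in> ?B" "f q = f p - 1 \<or> f q = f p + 1" "even (f p)" for q
  proof -
    have "f p \<noteq> v' + 1" "f p \<noteq> v' + n'" using that par by auto
    then show ?thesis using inside[OF that(1)] that(2) fp by auto
  qed
  have ev: "even (f p)" if "p mod 4 = 0 \<or> p mod 4 = 2"
    using wm that unfolding windmill_def even_mod_4 by blast
  have "rising ?B' f p" if "p mod 4 = 2"
  proof -
    have "rising ?B f p" using wm that unfolding windmill_def by blast
    then show ?thesis unfolding rising_def using near ev that by blast
  qed
  moreover have "falling ?B' f p" if "p mod 4 = 0"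
  proof -
    have "falling ?B f p" using wm that unfolding windmill_def by blast
    then show ?thesis unfolding falling_def using near ev that by blast
  qed
  ultimately show "windmill ?B' f p" using wm unfolding windmill_def by blast
qed

lemma snow_box_shift:
  assumes box: "snow_box i v n f" and "4 dvd d" "4 dvd e"
  shows "snow_box (i + d) (v + e) n (\<lambda>x. f (x - d) + e)"
  unfolding snow_box_def
proof
  have b: "bij_betw f {i<..i+n} {v<..v+n}" using box unfolding snow_box_def by simp
  have b1: "bij_betw (\<lambda>x. x - d) {i + d<..i + d + n} {i<..i+n}"
    by (rule bij_betwI[where g = "\<lambda>x. x + d"]) auto
  have b2: "bij_betw (\<lambda>x. x + e) {v<..v+n} {v + e<..v + e + n}"
    by (rule bij_betwI[where g = "\<lambda>x. x - e"]) auto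
  show "bij_betw (\<lambda>x. f (x - d) + e) {i + d<..i + d + n} {v + e<..v + e + n}"
    using bij_betw_trans[OF bij_betw_trans[OF b1 b] b2] by (simp add: o_def)
  show "\<forall>p\<in>{i + d<..i + d + n}. windmill {i + d<..i + d + n} (\<lambda>x. f (x - d) + e) p"
  proof
    fix p assume p: "p \<in> {i + d<..i + d + n}"
    define r where "r = p - d"
    have wm: "windmill {i<..i+n} f r" using box p unfolding snow_box_def r_def by auto
    have m: "(f r + e) mod 4 = f r mod 4" "p mod 4 = r mod 4" "even p = even r" "even (f r + e) = even (f r)"
      using assms(2,3) unfolding r_def by presburger+
    have 1: "rising {i + d<..i + d + n} (\<lambda>x. f (x - d) + e) p" if "rising {i<..i+n} f r"
    proof -
      from that obtain q s where "q \<in> {i<..i+n}" "f q = f r - 1" "q < r"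
          "\<And>z. q < z \<Longrightarrow> z < r \<Longrightarrow> f z < f r"
        and "s \<in> {i<..i+n}" "f s = f r + 1" "r < s"
          "\<And>z. r < z \<Longrightarrow> z < s \<Longrightarrow> f r < f z"
        by (rule risingE) blast
      then show ?thesis
        by (intro risingI[of "q + d" _ _ _ "s + d"]) (auto simp: r_def)
    qed
    have 2: "falling {i + d<..i + d + n} (\<lambda>x. f (x - d) + e) p" if "falling {i<..i+n} f r"
    proof -
      from that obtain q s where "q \<in> {i<..i+n}" "f q = f r - 1" "r < q"
          "\<And>z. r < z \<Longrightarrow> z < q \<Longrightarrow> f z < f r"
        and "s \<in> {i<..i+n}" "f s = f r + 1" "s < r"
          "\<And>z. s < z \<Longrightarrow> z < r \<Longrightarrow> f r < f z"
        by (rule fallingE) blast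
      then show ?thesis
        by (intro fallingI[of "q + d" _ _ _ "s + d"]) (auto simp: r_def)
    qed
    show "windmill {i + d<..i + d + n} (\<lambda>x. f (x - d) + e) p"
      using wm 1 2 unfolding windmill_def r_def[symmetric] m by simp
  qed
qed

text \<open>
  Complementing values turns rising into falling windmills.  The shift of the positions by 2
  exchanges the residues 0 and 2 and so restores the required orientation.
\<close>
lemma snow_box_flip:
  assumes box: "snow_box i v n f"
  shows "snow_box (i + 2) (1 - v - n) n (\<lambda>x. 2 - f (x - 2))"
  unfolding snow_box_def
proof
  have b: "bij_betw f {i<..i+n} {v<..v+n}" using box unfolding snow_box_def by simp
  have b1: "bij_betw (\<lambda>x. x - 2) {i + 2<..i + 2 + n} {i<..i+n}"
    by (rule bij_betwI[where g = "\<lambda>x. x + 2"]) auto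
  have b2: "bij_betw (\<lambda>x. 2 - x) {v<..v+n} {1 - v - n<..1 - v - n + n}"
    by (rule bij_betwI[where g = "\<lambda>x. 2 - x"]) auto
  show "bij_betw (\<lambda>x. 2 - f (x - 2)) {i + 2<..i + 2 + n} {1 - v - n<..1 - v - n + n}"
    using bij_betw_trans[OF bij_betw_trans[OF b1 b] b2] by (simp add: o_def)
  show "\<forall>p\<in>{i + 2<..i + 2 + n}. windmill {i + 2<..i + 2 + n} (\<lambda>x. 2 - f (x - 2)) p"
  proof
    fix p assume p: "p \<in> {i + 2<..i + 2 + n}"
    define r where "r = p - 2"
    have wm: "windmill {i<..i+n} f r" using box p unfolding snow_box_def r_def by auto
    have m: "p mod 4 = 2 \<longleftrightarrow> r mod 4 = 0" "p mod 4 = 0 \<longleftrightarrow> r mod 4 = 2" "even p = even r" "even (2 - f r) = even (f r)"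
      unfolding r_def by presburger+
    have m2: "(2 - f r) mod 4 = p mod 4" if "f r mod 4 = r mod 4" "even r"
      using that unfolding r_def by presburger
    have 1: "falling {i + 2<..i + 2 + n} (\<lambda>x. 2 - f (x - 2)) p" if "rising {i<..i+n} f r"
    proof -
      from that obtain q s where "q \<in> {i<..i+n}" "f q = f r - 1" "q < r"
          "\<And>z. q < z \<Longrightarrow> z < r \<Longrightarrow> f z < f r"
        and "s \<in> {i<..i+n}" "f s = f r + 1" "r < s"
          "\<And>z. r < z \<Longrightarrow> z < s \<Longrightarrow> f r < f z"
        by (rule risingE) blast
      then show ?thesis
        by (intro fallingI[of "s + 2" _ _ _ "q + 2"]) (auto simp: r_def)
    qed
    have 2: "rising {i + 2<..i + 2 + n} (\<lambda>x. 2 - f (x - 2)) p" if "falling {i<..i+n} f r"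
    proof -
      from that obtain q s where "q \<in> {i<..i+n}" "f q = f r - 1" "r < q"
          "\<And>z. r < z \<Longrightarrow> z < q \<Longrightarrow> f z < f r"
        and "s \<in> {i<..i+n}" "f s = f r + 1" "s < r"
          "\<And>z. s < z \<Longrightarrow> z < r \<Longrightarrow> f r < f z"
        by (rule fallingE) blast
      then show ?thesis
        by (intro risingI[of "s + 2" _ _ _ "q + 2"]) (auto simp: r_def)
    qed
    show "windmill {i + 2<..i + 2 + n} (\<lambda>x. 2 - f (x - 2)) p"
      using wm 1 2 m2 unfolding windmill_def r_def[symmetric] m by simp
  qed
qed

text \<open>
  A half turn preserves orientations; it turns statements about the first entry into
  statements about the last one.
\<close>
lemma snow_box_rotate:
  assumes box: "snow_box i v n f"
  shows "snow_box (- i - n - 1) (- v - n - 1) n (\<lambda>x. - f (- x))"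
  unfolding snow_box_def
proof
  let ?I = "{- i - n - 1<..- i - n - 1 + n}" and ?g = "\<lambda>x. - f (- x)"
  have b: "bij_betw f {i<..i+n} {v<..v+n}" using box unfolding snow_box_def by simp
  have b1: "bij_betw uminus {- i - n - 1<..- i - n - 1 + n} {i<..i+n}" for i :: int
    by (rule bij_betwI[where g = uminus]) auto
  have b2: "bij_betw uminus {v<..v+n} {- v - n - 1<..- v - n - 1 + n}"
    by (rule bij_betwI[where g = uminus]) auto
  show "bij_betw ?g ?I {- v - n - 1<..- v - n - 1 + n}"
    using bij_betw_trans[OF bij_betw_trans[OF b1 b] b2] by (simp add: o_def)
  show "\<forall>p\<in>?I. windmill ?I ?g p"
  proof
    fix p assume p: "p \<in> ?I"
    define r where "r = - p"
    have wm: "windmill {i<..i+n} f r" using box p unfolding snow_box_def r_def by auto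
    have m: "p mod 4 = 2 \<longleftrightarrow> r mod 4 = 2" "p mod 4 = 0 \<longleftrightarrow> r mod 4 = 0" "even p = even r" "even (- f r) = even (f r)"
      unfolding r_def by presburger+
    have m2: "(- f r) mod 4 = p mod 4" if "f r mod 4 = r mod 4" "even r"
      using that unfolding r_def by presburger
    have 1: "rising ?I ?g p" if "rising {i<..i+n} f r"
    proof -
      from that obtain q s where "q \<in> {i<..i+n}" "f q = f r - 1" "q < r"
          "\<And>z. q < z \<Longrightarrow> z < r \<Longrightarrow> f z < f r"
        and "s \<in> {i<..i+n}" "f s = f r + 1" "r < s"
          "\<And>z. r < z \<Longrightarrow> z < s \<Longrightarrow> f r < f z"
        by (rule risingE) blast
      then show ?thesis
        by (intro risingI[of "-s" _ _ _ "-q"]) (auto simp: r_def)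
    qed
    have 2: "falling ?I ?g p" if "falling {i<..i+n} f r"
    proof -
      from that obtain q s where "q \<in> {i<..i+n}" "f q = f r - 1" "r < q"
          "\<And>z. r < z \<Longrightarrow> z < q \<Longrightarrow> f z < f r"
        and "s \<in> {i<..i+n}" "f s = f r + 1" "s < r"
          "\<And>z. s < z \<Longrightarrow> z < r \<Longrightarrow> f r < f z"
        by (rule fallingE) blast
      then show ?thesis
        by (intro fallingI[of "-s" _ _ _ "-q"]) (auto simp: r_def)
    qed
    show "windmill ?I ?g p"
      using wm 1 2 m2 unfolding windmill_def r_def[symmetric] m by simp
  qed
qed

text \<open>
  Otherwise the cut of the rotated box, read backwards, would put the first entry above
  some other value, but the first entry is the least.
\<close>
lemma last_is_greatest:
  assumes box: "snow_box i v n f" and i: "i mod 4 = 0" and v: "v mod 4 = 0" and n: "n mod 4 = 3" "0 \<le> n"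
    and first: "f (i + 1) = v + 1"
  shows "f (i + n) = v + n"
proof (rule ccontr)
  assume ne: "f (i + n) \<noteq> v + n"
  let ?g = "\<lambda>x. - f (- x)" and ?i = "- i - n - 1" and ?v = "- v - n - 1"
  have gbox: "snow_box ?i ?v n ?g" by (rule snow_box_rotate[OF box])
  have "n \<ge> 3" using n by presburger
  then have "f (i + n) \<in> {v<..v+n}" using snow_box_in[OF box] by auto
  then have "f (i + n) + 1 \<in> {v<..v+n}" using ne by auto
  then obtain p where p: "p \<in> {i<..i+n}" "f p = f (i + n) + 1" by (rule snow_box_onto[OF box])
  have a: "?i mod 4 = 0" "?v mod 4 = 0" using i v n by presburger+
  have mp: "- p \<in> {?i<..?i+n}" "?g (- p) = ?g (?i + 1) - 1" using p by (auto simp: add.commute)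
  note cut = cut_at_predecessor[OF gbox a n(1) mp]
  have "i + 1 \<noteq> p" using cut(1) i by presburger
  moreover have "i + 1 \<in> {i<..i+n}" using p by auto
  ultimately have "f p < f (i + 1)" using cut(3)[of "- i - 1"] p by (auto simp: add.commute)
  then show False using snow_box_in[OF box p(1)] first by auto
qed

section \<open>Gluing and splitting boxes\<close>

lemma snow_box_glue:
  assumes box1: "snow_box i u m f" and box2: "snow_box (i + m + 1) v n f"
    and mid: "f (i + m + 1) = u" and u: "u = v + n + 1"
    and mods: "i mod 4 = 0" "u mod 4 = 0" "m mod 4 = 3" and pos: "0 < m" "0 < n"
  shows "snow_box i v (m + n + 1) f"
proof -
  let ?P = "i + m + 1"
  let ?B = "{i<..i + (m + n + 1)}"
  have b1: "bij_betw f {i<..i+m} {u<..u+m}" and b2: "bij_betw f {?P<..?P+n} {v<..v+n}"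
    using box1 box2 unfolding snow_box_def by simp_all
  have bm: "bij_betw f {?P} {u}" using mid by (simp add: bij_betw_def)
  have bij: "bij_betw f ?B {v<..v + (m + n + 1)}"
  proof -
    have "bij_betw f (({i<..i+m} \<union> {?P}) \<union> {?P<..?P+n}) (({u<..u+m} \<union> {u}) \<union> {v<..v+n})"
      using u by (intro bij_betw_combine b1 bm b2) auto
    moreover have "({i<..i+m} \<union> {?P}) \<union> {?P<..?P+n} = ?B" using pos by auto
    moreover have "({u<..u+m} \<union> {u}) \<union> {v<..v+n} = {v<..v + (m + n + 1)}" using pos u by auto
    ultimately show ?thesis by simp
  qed
  have P: "?P mod 4 = 0" using mods by presburger
  have "windmill ?B f p" if p: "p \<in> ?B" for p
  proof -
    consider "p \<in> {i<..i+m}" | "p = ?P" | "p \<in> {?P<..?P+n}" using p by force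
    then show ?thesis
    proof cases
      case 1
      then show ?thesis using pos by (intro windmill_mono[OF snow_box_windmill[OF box1 1], of ?B]) auto
    next
      case 3
      then show ?thesis using pos by (intro windmill_mono[OF snow_box_windmill[OF box2 3], of ?B]) auto
    next
      case 2
      have "u - 1 \<in> {v<..v+n}" "u + 1 \<in> {u<..u+m}" using u pos by auto
      then obtain q s where q: "q \<in> {?P<..?P+n}" "f q = u - 1" and s: "s \<in> {i<..i+m}" "f s = u + 1"
        using snow_box_onto[OF box2, of "u - 1"] snow_box_onto[OF box1, of "u + 1"] by metis
      have "falling ?B f ?P"
      proof (rule fallingI[of q _ _ _ s])
        show "f z < f ?P" if "?P < z" "z < q" for z
          using snow_box_in[OF box2, of z] that q mid u by auto
        show "f ?P < f z" if "s < z" "z < ?P" for z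
          using snow_box_in[OF box1, of z] that s mid u by auto
      qed (use q s mid pos in auto)
      then show ?thesis using P mods mid 2 unfolding windmill_def by (auto simp: even_mod_4)
    qed
  qed
  then show ?thesis using bij unfolding snow_box_def by blast
qed

text \<open>
  The case \<open>n = -1\<close>, an empty inner box, is included: then positions \<open>i + 2\<close> and \<open>i + n + 3\<close>
  coincide and the result is a box with three entries.
\<close>
lemma snow_box_frame:
  assumes box: "snow_box (i + 2) (v + 2) n f"
    and corners: "f (i + 1) = v + 1" "f (i + 2) = v + 2" "f (i + n + 3) = v + n + 3" "f (i + n + 4) = v + n + 4"
    and mods: "i mod 4 = 0" "v mod 4 = 0" "n mod 4 = 3" and pos: "-1 \<le> n"
  shows "snow_box i v (n + 4) f"
proof -
  let ?B = "{i<..i + (n + 4)}" and ?V = "{v<..v + (n + 4)}"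
  let ?I = "{i + 2<..i + 2 + n}"
  have bI: "bij_betw f ?I {v + 2<..v + 2 + n}" using box unfolding snow_box_def by simp
  have split: "?B = {i + 1, i + 2, i + n + 3, i + n + 4} \<union> ?I" using pos by auto
  have "f ` ?B = {v + 1, v + 2, v + n + 3, v + n + 4} \<union> {v + 2<..v + 2 + n}"
    unfolding split image_Un using bI corners by (simp add: bij_betw_def)
  also have "\<dots> = ?V" using pos by auto
  finally have img: "f ` ?B = ?V" .
  have bij: "bij_betw f ?B ?V"
    by (intro bij_betw_imageI img eq_card_imp_inj_on) (simp_all add: img)
  have lo: "v + 2 < f z" if "z \<in> ?B" "i + 2 < z" for z
    using that corners snow_box_in[OF box, of z] pos unfolding split by auto
  have hi: "f z < v + n + 3" if "z \<in> ?B" "z < i + n + 3" for z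
    using that corners snow_box_in[OF box, of z] pos unfolding split by auto
  have onto: "\<exists>x\<in>?B. f x = w" if "w \<in> ?V" for w using img that by (metis imageE)
  have r1: "rising ?B f (i + 2)"
  proof -
    obtain s where s: "s \<in> ?B" "f s = v + 3" using onto[of "v + 3"] pos by auto
    have "s \<noteq> i + 1" "s \<noteq> i + 2" using s corners by auto
    then have "i + 2 < s" using s(1) by auto
    then show ?thesis using s corners pos lo
      by (intro risingI[of "i + 1" _ _ _ s]) auto
  qed
  have r2: "rising ?B f (i + n + 3)"
  proof -
    obtain s where s: "s \<in> ?B" "f s = v + n + 2" using onto[of "v + n + 2"] pos by auto
    have "s \<noteq> i + n + 3" "s \<noteq> i + n + 4" using s corners by auto
    then have "s < i + n + 3" using s(1) by auto
    then show ?thesis using s corners pos hi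
      by (intro risingI[of s _ _ _ "i + n + 4"]) auto
  qed
  have "windmill ?B f p" if p: "p \<in> ?B" for p
  proof -
    consider "p \<in> ?I" | "p = i + 1" | "p = i + 2" | "p = i + n + 3" | "p = i + n + 4"
      using p unfolding split by blast
    then show ?thesis
    proof cases
      case 1
      then show ?thesis by (intro windmill_mono[OF snow_box_windmill[OF box 1], of ?B]) auto
    next
      case 2
      have "odd (i + 1)" "odd (v + 1)" using mods by presburger+
      then show ?thesis using 2 corners unfolding windmill_def by (simp add: even_mod_4)
    next
      case 3
      have "(i + 2) mod 4 = 2" "(v + 2) mod 4 = 2" "even (i + 2)" "even (v + 2)" using mods by presburger+
      then show ?thesis using corners r1 unfolding 3 windmill_def corners by simp
    next
      case 4
      have "(i + n + 3) mod 4 = 2" "(v + n + 3) mod 4 = 2" "even (i + n + 3)" "even (v + n + 3)"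
        using mods by presburger+
      then show ?thesis using r2 unfolding 4 windmill_def corners by simp
    next
      case 5
      have "odd (i + n + 4)" "odd (v + n + 4)" using mods by presburger+
      then show ?thesis using 5 corners unfolding windmill_def by (simp add: even_mod_4)
    qed
  qed
  then show ?thesis using bij unfolding snow_box_def by blast
qed

text \<open>
  The converse of \<open>snow_box_frame\<close>.  Between the least value and the windmill of value
  \<open>v + 2\<close> every entry would have to lie below \<open>v + 2\<close>, so the two are adjacent; likewise at
  the other end.
\<close>
lemma snow_box_interior:
  assumes box: "snow_box i v n f" and mods: "i mod 4 = 0" "v mod 4 = 0" "n mod 4 = 3" and pos: "3 \<le> n"
    and first: "f (i + 1) = v + 1"
  shows "f (i + 2) = v + 2" "f (i + n - 1) = v + n - 1" "f (i + n) = v + n"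
    "snow_box (i + 2) (v + 2) (n - 4) f"
proof -
  let ?B = "{i<..i+n}"
  have wm: "windmill ?B f p" if "p \<in> ?B" for p using snow_box_windmill[OF box that] .
  have inj: "x = y" if "x \<in> ?B" "y \<in> ?B" "f x = f y" for x y using snow_box_inj[OF box that] .
  have mem: "i + 1 \<in> ?B" "i + 2 \<in> ?B" "i + n - 1 \<in> ?B" "i + n \<in> ?B" using pos by auto
  show last: "f (i + n) = v + n" using last_is_greatest[OF box mods _ first] pos by simp
  show second: "f (i + 2) = v + 2"
  proof -
    have "v + 2 \<in> {v<..v+n}" using pos by simp
    then obtain p where p: "p \<in> ?B" "f p = v + 2" by (rule snow_box_onto[OF box])
    have "even (v + 2)" using mods by presburger
    then have "even p" using wm[OF p(1)] p(2) unfolding windmill_def by simp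
    have "p \<noteq> i + 1" using p first by auto
    have "i + 2 = p"
    proof (rule ccontr)
      assume "i + 2 \<noteq> p"
      then have "i + 2 < p" using p(1) \<open>p \<noteq> i + 1\<close> by auto
      then have "f (i + 2) < f p"
        using between_arm(1)[OF box p(1) mem(1) \<open>even p\<close>, of "i + 2"] p(2) first by simp
      then have "f (i + 2) = v + 1" using p(2) snow_box_in[OF box mem(2)] by simp
      then show False using inj[OF mem(1,2)] first by simp
    qed
    then show ?thesis using p by simp
  qed
  show third: "f (i + n - 1) = v + n - 1"
  proof -
    have "v + n - 1 \<in> {v<..v+n}" using pos by simp
    then obtain p where p: "p \<in> ?B" "f p = v + n - 1" by (rule snow_box_onto[OF box])
    have "even (v + n - 1)" using mods by presburger
    then have "even p" using wm[OF p(1)] p(2) unfolding windmill_def by simp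
    have "p \<noteq> i + n" using p last by auto
    have "i + n - 1 = p"
    proof (rule ccontr)
      assume "i + n - 1 \<noteq> p"
      then have "p < i + n - 1" using p(1) \<open>p \<noteq> i + n\<close> by auto
      then have "f p < f (i + n - 1)"
        using between_arm(2)[OF box p(1) mem(4) \<open>even p\<close>, of "i + n - 1"] p(2) last by simp
      then have "f (i + n - 1) = v + n" using p(2) snow_box_in[OF box mem(3)] by simp
      then show False using inj[OF mem(3,4)] last by simp
    qed
    then show ?thesis using p by simp
  qed
  show "snow_box (i + 2) (v + 2) (n - 4) f"
  proof (rule snow_box_restrict[OF box])
    show "even (v + 2)" "odd (v + 2 + (n - 4))" using mods by presburger+
    let ?I = "{i + 2<..i + 2 + (n - 4)}" and ?W = "{v + 2<..v + 2 + (n - 4)}"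
    have in_iff: "x \<in> ?I \<longleftrightarrow> f x \<in> ?W" if x: "x \<in> ?B" for x
    proof -
      have "f x = v + 1 \<longleftrightarrow> x = i + 1" "f x = v + 2 \<longleftrightarrow> x = i + 2"
        "f x = v + n - 1 \<longleftrightarrow> x = i + n - 1" "f x = v + n \<longleftrightarrow> x = i + n"
        using inj[OF x] mem first second third last by metis+
      then show ?thesis using x snow_box_in[OF box x] by auto
    qed
    show "bij_betw f ?I ?W"
    proof (rule bij_betwI')
      show "f x = f y \<longleftrightarrow> x = y" if "x \<in> ?I" "y \<in> ?I" for x y using that inj[of x y] by auto
      show "f x \<in> ?W" if "x \<in> ?I" for x using that in_iff[of x] by auto
      show "\<exists>x\<in>?I. w = f x" if w: "w \<in> ?W" for w
      proof -
        have "w \<in> {v<..v+n}" using w by auto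
        then obtain x where "x \<in> ?B" "f x = w" by (rule snow_box_onto[OF box])
        then show ?thesis using in_iff[of x] w by blast
      qed
    qed
  qed auto
qed

text \<open>
  The converse of \<open>snow_box_glue\<close>, for a box whose first value is not its least one.
\<close>
lemma snow_box_cut:
  assumes box: "snow_box i v n f" and mods: "i mod 4 = 0" "v mod 4 = 0" "n mod 4 = 3"
    and pos: "0 < n" and first: "f (i + 1) \<noteq> v + 1"
  obtains m k where "0 < m" "0 < k" "n = m + k + 1" "m mod 4 = 3" "k mod 4 = 3"
    "f (i + 1) = v + k + 2" "f (i + m + 1) = v + k + 1"
    "snow_box i (v + k + 1) m f" "snow_box (i + m + 1) v k f"
proof -
  let ?B = "{i<..i+n}"
  have i1: "i + 1 \<in> ?B" using pos by simp
  have inj: "x = y" if "x \<in> ?B" "y \<in> ?B" "f x = f y" for x y using snow_box_inj[OF box that] .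
  have "f (i + 1) - 1 \<in> {v<..v+n}" using snow_box_in[OF box i1] first by auto
  then obtain P where P: "P \<in> ?B" "f P = f (i + 1) - 1" by (rule snow_box_onto[OF box])
  note cut = cut_at_predecessor[OF box mods P]
  define m where "m = P - i - 1"
  define k where "k = i + n - P"
  have mk: "n = m + k + 1" "P = i + m + 1" unfolding m_def k_def by auto
  have mods': "m mod 4 = 3" "k mod 4 = 3" using cut(1) mods unfolding m_def k_def by presburger+
  have "0 \<le> m" "0 \<le> k" using P(1) unfolding m_def k_def by auto
  moreover have "m \<noteq> 0" "k \<noteq> 0" using mods' by auto
  ultimately have pos': "0 < m" "0 < k" by auto
  have bR: "bij_betw f {P<..i+n} {v<..f P - 1}"
  proof (rule bij_betwI')
    show "f x = f y \<longleftrightarrow> x = y" if "x \<in> {P<..i+n}" "y \<in> {P<..i+n}" for x y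
      using that inj[of x y] P(1) by auto
    show "f x \<in> {v<..f P - 1}" if "x \<in> {P<..i+n}" for x
      using that cut(3)[of x] snow_box_in[OF box, of x] P(1) by auto
    show "\<exists>x\<in>{P<..i+n}. w = f x" if w: "w \<in> {v<..f P - 1}" for w
    proof -
      have "w \<in> {v<..v+n}" using w snow_box_in[OF box P(1)] by auto
      then obtain x where x: "x \<in> ?B" "f x = w" by (rule snow_box_onto[OF box])
      then have "P < x" using cut(2)[of x] w by (cases "x = P") force+
      then show ?thesis using x by auto
    qed
  qed
  have "card {P<..i+n} = card {v<..f P - 1}" by (rule bij_betw_same_card[OF bR])
  then have fP: "f P = v + k + 1" using snow_box_in[OF box P(1)] P(1) unfolding k_def by auto
  have bL: "bij_betw f {i<..P - 1} {f P<..v+n}"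
  proof (rule bij_betwI')
    show "f x = f y \<longleftrightarrow> x = y" if "x \<in> {i<..P - 1}" "y \<in> {i<..P - 1}" for x y
      using that inj[of x y] P(1) by auto
    show "f x \<in> {f P<..v+n}" if "x \<in> {i<..P - 1}" for x
      using that cut(2)[of x] snow_box_in[OF box, of x] P(1) by auto
    show "\<exists>x\<in>{i<..P - 1}. w = f x" if w: "w \<in> {f P<..v+n}" for w
    proof -
      have "w \<in> {v<..v+n}" using w snow_box_in[OF box P(1)] by auto
      then obtain x where x: "x \<in> ?B" "f x = w" by (rule snow_box_onto[OF box])
      then have "x < P" using cut(3)[of x] w by (cases "x = P") force+
      then show ?thesis using x by auto
    qed
  qed
  have vk: "(v + k + 1) mod 4 = 0" using mods mods' by presburger
  have L: "snow_box i (v + k + 1) m f"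
  proof (rule snow_box_restrict[OF box])
    show "even (v + k + 1)" "odd (v + k + 1 + m)" using vk mods' by presburger+
    show "bij_betw f {i<..i + m} {v + k + 1<..v + k + 1 + m}" using bL fP mk by (simp add: algebra_simps)
  qed (use mk pos' in auto)
  have R: "snow_box (i + m + 1) v k f"
  proof (rule snow_box_restrict[OF box])
    show "even v" "odd (v + k)" using mods mods' by presburger+
    show "bij_betw f {i + m + 1<..i + m + 1 + k} {v<..v + k}" using bR fP mk by (simp add: algebra_simps)
  qed (use mk pos' in auto)
  show ?thesis using that[OF pos' mk(1) mods' _ _ L R] P(2) fP mk by simp
qed


section \<open>Shapes of complete Baxter permutations\<close>

definition compl :: "nat list \<Rightarrow> nat list" where
  "compl p = map (\<lambda>v. length p + 1 - v) p"

text \<open>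
  The operation $\ominus$ on permutations proper.
\<close>
definition skew :: "nat list \<Rightarrow> nat list \<Rightarrow> nat list" where
  "skew x y = map ((+) (length y)) x @ y"

text \<open>
  This is $1 \ominus g$, so that $x \ominus 1 \ominus g$ becomes \<open>skew x (lead g)\<close> for every
  \<open>g\<close>, with $1 \ominus @ = \emptyset$ built in.
\<close>
fun lead :: "aperm \<Rightarrow> nat list" where
  "lead Anti = []"
| "lead (Perm y) = skew [1] y"

text \<open>
  This is $1 \oplus c(g) \oplus 1$, where $1 \oplus @ \oplus 1 = 1$.
\<close>
fun frame :: "aperm \<Rightarrow> nat list" where
  "frame Anti = [1]"
| "frame (Perm p) = 1 # map Suc (compl p) @ [length p + 2]"

text \<open>
  This is $1 \oplus 1 \oplus c(g) \oplus 1 \oplus 1$, the frame of complete Baxter permutations: two of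
  the four added entries are even.  The antipermutation cancels one of them.
\<close>
fun wide_frame :: "aperm \<Rightarrow> nat list" where
  "wide_frame Anti = [1, 2, 3]"
| "wide_frame (Perm p) = 1 # 2 # map ((+) 2) (compl p) @ [length p + 3, length p + 4]"

text \<open>
  The recursive decomposition is recorded by a binary tree; a complete Baxter permutation, the
  snow leopard permutation in it, and the two threads are functions of the same tree.
\<close>
datatype shape = Leaf | Node shape shape

fun baxter_of :: "shape \<Rightarrow> aperm" where
  "baxter_of Leaf = Anti"
| "baxter_of (Node l r) = Perm (skew (wide_frame (baxter_of l)) (lead (baxter_of r)))"

definition box_list :: "int \<Rightarrow> int \<Rightarrow> int \<Rightarrow> (int \<Rightarrow> int) \<Rightarrow> nat list" where
  "box_list i v n f = map (\<lambda>x. nat (f x - v)) [i+1..i+n]"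

definition box_aperm :: "int \<Rightarrow> int \<Rightarrow> int \<Rightarrow> (int \<Rightarrow> int) \<Rightarrow> aperm" where
  "box_aperm i v n f = (if n < 0 then Anti else Perm (box_list i v n f))"

lemma length_compl [simp]: "length (compl p) = length p"
  unfolding compl_def by simp

lemma length_skew [simp]: "length (skew x y) = length x + length y"
  unfolding skew_def by simp

lemma skew_Nil [simp]: "skew x [] = x" "skew [] y = y"
  unfolding skew_def by (simp_all add: map_idI)

lemma length_box_list [simp]: "length (box_list i v n f) = nat n"
  unfolding box_list_def by simp

text \<open>
  The induction hypothesis is applied to the flipped inner box, since the frame contains the
  complement of a smaller permutation.
\<close>
lemma framed_box:
  assumes box: "snow_box i v n f" and mods: "i mod 4 = 0" "v mod 4 = 0" "n mod 4 = 3" and pos: "3 \<le> n"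
    and first: "f (i + 1) = v + 1"
    and IH: "\<And>i v f. i mod 4 = 0 \<Longrightarrow> v mod 4 = 0 \<Longrightarrow> snow_box i v (n - 4) f \<Longrightarrow>
               \<exists>t. baxter_of t = box_aperm i v (n - 4) f"
  shows "\<exists>l. box_list i v n f = wide_frame (baxter_of l)"
proof (cases "n = 3")
  case True
  note int = snow_box_interior[OF box mods pos first]
  have "[i+1..i+3] = [i+1, i+2, i+3]" by (simp add: upto.simps)
  then have "box_list i v n f = [1, 2, 3]" using int first True unfolding box_list_def by simp
  then show ?thesis by (intro exI[of _ Leaf]) simp
next
  case False
  then have n: "7 \<le> n" using mods pos by presburger
  note int = snow_box_interior[OF box mods pos first]
  let ?g = "\<lambda>x. 2 - f (x - 2)"
  have flip: "snow_box (i + 4) (3 - v - n) (n - 4) ?g"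
    using snow_box_flip[OF int(4)] by (simp add: algebra_simps)
  have "(i + 4) mod 4 = 0" "(3 - v - n) mod 4 = 0" using mods by presburger+
  from IH[OF this flip] obtain l where l: "baxter_of l = box_aperm (i + 4) (3 - v - n) (n - 4) ?g" ..
  define bl where "bl = box_list (i + 4) (3 - v - n) (n - 4) ?g"
  have bl: "baxter_of l = Perm bl" using l n unfolding box_aperm_def bl_def by simp
  have len: "length bl = nat (n - 4)" unfolding bl_def by simp
  have eq: "map ((+) 2) (compl bl) = map (\<lambda>x. nat (f x - v)) [i+3..i+n-2]"
  proof (rule nth_equalityI)
    show "length (map ((+) 2) (compl bl)) = length (map (\<lambda>x. nat (f x - v)) [i+3..i+n-2])"
      using n len by simp
  next
    fix j assume "j < length (map ((+) 2) (compl bl))"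
    then have j: "j < nat (n - 4)" using len by simp
    define x where "x = i + 3 + int j"
    have x: "x \<in> {i + 2<..i + 2 + (n - 4)}" using j unfolding x_def by auto
    have "bl ! j = nat (?g (x + 2) - (3 - v - n))"
      using j unfolding bl_def box_list_def x_def by (simp add: nth_upto algebra_simps)
    then have blj: "bl ! j = nat (v + n - 1 - f x)" by (simp add: algebra_simps)
    have "f x \<in> {v + 2<..v + 2 + (n - 4)}" using snow_box_in[OF int(4) x] .
    then have "2 + (nat (n - 4) + 1 - nat (v + n - 1 - f x)) = nat (f x - v)" by auto
    moreover have "map ((+) 2) (compl bl) ! j = 2 + (nat (n - 4) + 1 - bl ! j)"
      using j len unfolding compl_def by simp
    moreover have "map (\<lambda>x. nat (f x - v)) [i+3..i+n-2] ! j = nat (f x - v)"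
      using j unfolding x_def by (simp add: nth_upto)
    ultimately show "map ((+) 2) (compl bl) ! j = map (\<lambda>x. nat (f x - v)) [i+3..i+n-2] ! j"
      using blj by simp
  qed
  have "[i+1..i+n] = [i+1..i+3-1] @ [i+3..i+n-2] @ [i+n-2+1..i+n]"
    using n upto_split1[of "i+1" "i+3" "i+n"] upto_split2[of "i+3" "i+n-2" "i+n"] by simp
  moreover have "[i+1..i+3-1] = [i+1, i+2]" by (simp add: upto.simps)
  moreover have "[i+n-2+1..i+n] = [i+n-1, i+n]" by (simp add: upto.simps)
  ultimately have "box_list i v n f =
      [nat (f (i+1) - v), nat (f (i+2) - v)] @ map ((+) 2) (compl bl) @ [nat (f (i+n-1) - v), nat (f (i+n) - v)]"
    unfolding box_list_def eq by simp
  also have "\<dots> = wide_frame (Perm bl)"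
    using int(1-3) first len n by (simp add: nat_diff_distrib)
  finally show ?thesis using bl by metis
qed

text \<open>
  The length \<open>-1\<close> stands for \<open>Anti\<close>.
\<close>
lemma snow_box_shape:
  assumes "snow_box i v n f" "i mod 4 = 0" "v mod 4 = 0" "n mod 4 = 3" "-1 \<le> n"
  shows "\<exists>t. baxter_of t = box_aperm i v n f"
  using assms
proof (induction "nat (n + 1)" arbitrary: i v n f rule: less_induct)
  case less
  note box = less.prems(1) and mods = less.prems(2-4)
  show ?case
  proof (cases "n < 0")
    case True
    then show ?thesis by (intro exI[of _ Leaf]) (simp add: box_aperm_def)
  next
    case False
    then have n3: "3 \<le> n" using mods less.prems(5) by presburger
    show ?thesis
    proof (cases "f (i + 1) = v + 1")
      case True
      have "\<exists>l. box_list i v n f = wide_frame (baxter_of l)"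
      proof (rule framed_box[OF box mods n3 True])
        show "\<exists>t. baxter_of t = box_aperm i' v' (n - 4) f'"
          if "i' mod 4 = 0" "v' mod 4 = 0" "snow_box i' v' (n - 4) f'" for i' v' f'
        proof (rule less.hyps[OF _ that(3,1,2)])
          show "(n - 4) mod 4 = 3" using mods by presburger
        qed (use n3 in auto)
      qed
      then obtain l where "box_list i v n f = wide_frame (baxter_of l)" ..
      then have "baxter_of (Node l Leaf) = box_aperm i v n f"
        using False by (simp add: box_aperm_def)
      then show ?thesis ..
    next
      case ne: False
      obtain m k where mk: "0 < m" "0 < k" "n = m + k + 1" "m mod 4 = 3" "k mod 4 = 3"
        "f (i + 1) = v + k + 2" "f (i + m + 1) = v + k + 1"
        "snow_box i (v + k + 1) m f" "snow_box (i + m + 1) v k f"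
        using snow_box_cut[OF box mods _ ne] n3 by auto
      have m': "(v + k + 1) mod 4 = 0" "(i + m + 1) mod 4 = 0" "3 \<le> m" using mods mk by presburger+
      have "\<exists>l. box_list i (v + k + 1) m f = wide_frame (baxter_of l)"
      proof (rule framed_box[OF mk(8) mods(1) m'(1) mk(4) m'(3)])
        show "f (i + 1) = v + k + 1 + 1" using mk by simp
        show "\<exists>t. baxter_of t = box_aperm i' v' (m - 4) f'"
          if "i' mod 4 = 0" "v' mod 4 = 0" "snow_box i' v' (m - 4) f'" for i' v' f'
        proof (rule less.hyps[OF _ that(3,1,2)])
          show "(m - 4) mod 4 = 3" using mk by presburger
        qed (use mk m' in auto)
      qed
      then obtain l where l: "box_list i (v + k + 1) m f = wide_frame (baxter_of l)" ..
      have "\<exists>r. baxter_of r = box_aperm (i + m + 1) v k f"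
        using less.hyps[OF _ mk(9) m'(2) mods(2) mk(5)] mk by simp
      then obtain r where r: "baxter_of r = Perm (box_list (i + m + 1) v k f)"
        using mk unfolding box_aperm_def by auto
      have "[i+1..i+n] = [i+1..i+m] @ (i+m+1) # [i+m+1+1..i+m+1+k]"
        using mk upto_split3[of "i+1" "i+m+1" "i+n"] by (simp add: algebra_simps)
      moreover have "map (\<lambda>x. nat (f x - v)) [i+1..i+m] = map ((+) (nat k + 1)) (box_list i (v + k + 1) m f)"
      proof -
        have "nat (f x - v) = nat k + 1 + nat (f x - (v + k + 1))" if "x \<in> {i<..i+m}" for x
          using snow_box_in[OF mk(8) that] mk(2) by auto
        then show ?thesis unfolding box_list_def by simp
      qed
      moreover have "nat (f (i + m + 1) - v) = nat k + 1" using mk by (simp add: nat_add_distrib)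
      ultimately have "box_list i v n f =
          map ((+) (nat k + 1)) (box_list i (v + k + 1) m f) @ (nat k + 1) # box_list (i + m + 1) v k f"
        unfolding box_list_def by simp
      also have "\<dots> = skew (wide_frame (baxter_of l)) (lead (baxter_of r))"
        unfolding r l[symmetric] using mk by (simp add: skew_def)
      finally have "baxter_of (Node l r) = box_aperm i v n f"
        using False by (simp add: box_aperm_def)
      then show ?thesis ..
    qed
  qed
qed

definition entry_fun :: "nat list \<Rightarrow> int \<Rightarrow> int" where
  "entry_fun b x = int (b ! nat (x - 1))"

definition snow_list :: "nat list \<Rightarrow> bool" where
  "snow_list b \<longleftrightarrow> length b mod 4 = 3 \<and> snow_box 0 0 (int (length b)) (entry_fun b)"

lemma snow_list_entry:
  assumes "snow_list b" "0 < x" "x \<le> int (length b)"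
  shows "1 \<le> entry_fun b x" "entry_fun b x \<le> int (length b)"
  using snow_box_in[of 0 0 "int (length b)" "entry_fun b" x] assms unfolding snow_list_def by auto

lemma snow_list_wide_frame:
  assumes "a = Anti \<or> (\<exists>p. a = Perm p \<and> snow_list p)"
  shows "snow_list (wide_frame a)"
proof (cases a)
  case Anti
  have "snow_box 0 0 (-1 + 4) (entry_fun [1, 2, 3])"
    by (rule snow_box_frame) (simp_all add: snow_box_empty entry_fun_def nth_Cons')
  then show ?thesis unfolding Anti snow_list_def by simp
next
  case (Perm p)
  then have p: "snow_list p" using assms by auto
  let ?n = "int (length p)" and ?h = "entry_fun (wide_frame a)"
  have len: "length p mod 4 = 3" using p unfolding snow_list_def by simp
  then have d: "4 dvd ?n + 1" by presburger
  have "snow_box (0 + 2 + 0) (1 - 0 - ?n + (?n + 1)) ?n (\<lambda>x. 2 - entry_fun p (x - 0 - 2) + (?n + 1))"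
    using p d unfolding snow_list_def by (intro snow_box_shift snow_box_flip) simp_all
  then have "snow_box (0 + 2) (0 + 2) ?n (\<lambda>x. 2 - entry_fun p (x - 2) + (?n + 1))" by simp
  then have "snow_box (0 + 2) (0 + 2) ?n ?h"
  proof (rule snow_box_cong)
    fix x assume x: "x \<in> {0 + 2<..0 + 2 + ?n}"
    define j where "j = nat (x - 3)"
    have j: "x = int j + 3" "j < length p" using x unfolding j_def by auto
    have pj: "1 \<le> p ! j" "p ! j \<le> length p"
      using snow_list_entry[OF p, of "int j + 1"] j unfolding entry_fun_def by simp_all
    have "nat (x - 1) = Suc (Suc j)" "nat (x - 2 - 1) = j" using j by auto
    then show "2 - entry_fun p (x - 2) + (?n + 1) = ?h x"
      using j pj unfolding Perm entry_fun_def by (simp add: compl_def nth_append of_nat_diff)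
  qed
  then have "snow_box 0 0 (?n + 4) ?h"
  proof (rule snow_box_frame)
    show "?n mod 4 = 3" using len by presburger
    show "?h (0 + 1) = 0 + 1" "?h (0 + 2) = 0 + 2" "?h (0 + ?n + 3) = 0 + ?n + 3" "?h (0 + ?n + 4) = 0 + ?n + 4"
      unfolding Perm entry_fun_def by (simp_all add: nat_add_distrib nth_append nth_Cons')
  qed simp_all
  moreover have "length (wide_frame a) = length p + 4" unfolding Perm by simp
  ultimately show ?thesis using len unfolding snow_list_def by simp
qed

lemma snow_list_skew_lead:
  assumes x: "snow_list x" and "a = Anti \<or> (\<exists>p. a = Perm p \<and> snow_list p)"
  shows "snow_list (skew x (lead a))"
proof (cases a)
  case Anti
  then show ?thesis using x by simp
next
  case (Perm y)
  then have y: "snow_list y" using assms by auto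
  let ?m = "int (length x)" and ?n = "int (length y)" and ?h = "entry_fun (skew x (lead a))"
  have len: "length x mod 4 = 3" "length y mod 4 = 3" using x y unfolding snow_list_def by simp_all
  then have d: "4 dvd ?m + 1" "4 dvd ?n + 1" by presburger+
  have s: "skew x (lead a) = map ((+) (length y + 1)) x @ (length y + 1) # y"
    unfolding Perm by (simp add: skew_def)
  have "snow_box (0 + 0) (0 + (?n + 1)) ?m (\<lambda>z. entry_fun x (z - 0) + (?n + 1))"
    using x d unfolding snow_list_def by (intro snow_box_shift) simp_all
  then have "snow_box (0 + 0) (0 + (?n + 1)) ?m ?h"
    by (rule snow_box_cong) (auto simp: s entry_fun_def nth_append)
  then have 1: "snow_box 0 (?n + 1) ?m ?h" by simp
  have "snow_box (0 + (?m + 1)) (0 + 0) ?n (\<lambda>z. entry_fun y (z - (?m + 1)) + 0)"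
    using y d unfolding snow_list_def by (intro snow_box_shift) simp_all
  then have "snow_box (0 + (?m + 1)) (0 + 0) ?n ?h"
  proof (rule snow_box_cong)
    fix z assume z: "z \<in> {0 + (?m + 1)<..0 + (?m + 1) + ?n}"
    define j where "j = nat (z - ?m - 2)"
    have j: "z = int j + ?m + 2" "j < length y" using z unfolding j_def by auto
    have "nat (z - 1) = length x + Suc j" "nat (z - (?m + 1) - 1) = j" using j by auto
    then show "entry_fun y (z - (?m + 1)) + 0 = ?h z" unfolding s entry_fun_def by (simp add: nth_append)
  qed
  then have 2: "snow_box (0 + ?m + 1) 0 ?n ?h" by simp
  have "snow_box 0 0 (?m + ?n + 1) ?h"
  proof (rule snow_box_glue[OF 1 2])
    show "?h (0 + ?m + 1) = ?n + 1" unfolding s entry_fun_def by (simp add: nth_append)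
    show "(?n + 1) mod 4 = 0" "?m mod 4 = 3" using len by presburger+
    show "0 < ?m" "0 < ?n" using len by (auto intro!: gr0I)
  qed simp_all
  moreover have "length (skew x (lead a)) = length x + length y + 1" unfolding Perm by simp
  ultimately show ?thesis using len unfolding snow_list_def by (simp add: algebra_simps) presburger
qed

lemma snow_list_baxter_of: "baxter_of t = Anti \<or> (\<exists>p. baxter_of t = Perm p \<and> snow_list p)"
proof (induction t)
  case (Node l r)
  then show ?case using snow_list_skew_lead[OF snow_list_wide_frame[OF Node(1)] Node(2)] by simp
qed simp


section \<open>Boxes as complete Baxter permutations\<close>

lemma card_even_upto: "card {y::nat. 1 \<le> y \<and> even y \<and> y \<le> x} = x div 2"
proof -
  have "{y::nat. 1 \<le> y \<and> even y \<and> y \<le> x} = (*) 2 ` {1..x div 2}" by (auto elim!: evenE)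
  then show ?thesis by (simp add: card_image inj_on_def)
qed

lemma card_odd_upto: "card {y::nat. 1 \<le> y \<and> odd y \<and> y \<le> x} = (x + 1) div 2"
proof -
  have "{y::nat. 1 \<le> y \<and> odd y \<and> y \<le> x} = (\<lambda>k. 2 * k + 1) ` {..<(x + 1) div 2}"
    by (auto elim!: oddE)
  then show ?thesis by (simp add: card_image inj_on_def)
qed

lemma induced_even:
  assumes "is_perm p" shows "induced even p = map (\<lambda>x. x div 2) (filter even p)"
proof -
  have "{y \<in> set (filter even p). y \<le> x} = {y. 1 \<le> y \<and> even y \<and> y \<le> x}" if "x \<in> set p" for x
    using assms that unfolding is_perm_def by auto
  then show ?thesis unfolding induced_def standardize_def using card_even_upto by simp
qed

lemma induced_odd:
  assumes "is_perm p" shows "induced odd p = map (\<lambda>x. (x + 1) div 2) (filter odd p)"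
proof -
  have "{y \<in> set (filter odd p). y \<le> x} = {y. 1 \<le> y \<and> odd y \<and> y \<le> x}" if "x \<in> set p" for x
    using assms that unfolding is_perm_def by auto
  then show ?thesis unfolding induced_def standardize_def using card_odd_upto by simp
qed

lemma filter_odd_alternate:
  assumes "\<And>i. i < length b \<Longrightarrow> odd (b ! i) \<longleftrightarrow> even i"
  shows "filter odd b = map (\<lambda>j. b ! (2 * j)) [0..<(length b + 1) div 2]"
  using assms
proof (induction b rule: induct_list012)
  case (3 x y zs)
  have "odd (zs ! i) \<longleftrightarrow> even i" if "i < length zs" for i
    using 3(3)[of "i + 2"] that by simp
  then have IH: "filter odd zs = map (\<lambda>j. zs ! (2 * j)) [0..<(length zs + 1) div 2]" by (rule 3(1))
  have "odd x" "even y" using 3(3)[of 0] 3(3)[of 1] by auto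
  moreover have "[0..<(length (x # y # zs) + 1) div 2] = 0 # map Suc [0..<(length zs + 1) div 2]"
    unfolding map_Suc_upt by (subst upt_conv_Cons) auto
  ultimately show ?case using IH by simp
qed auto

definition parity_perm :: "nat list \<Rightarrow> bool" where
  "parity_perm b \<longleftrightarrow> is_perm b \<and> odd (length b) \<and>
     (\<forall>i\<in>{1..length b}. even (entry b i) \<longleftrightarrow> even i)"

lemma entry_in:
  assumes "is_perm p" "i \<in> {1..length p}" shows "entry p i \<in> {1..length p}"
  using nth_mem[of "i - 1" p] assms unfolding is_perm_def entry_def by auto

lemma entry_inj:
  assumes "is_perm p" "i \<in> {1..length p}" "j \<in> {1..length p}" "entry p i = entry p j" shows "i = j"
proof -
  have "i - 1 = j - 1"
    using assms nth_eq_iff_index_eq[of p "i - 1" "j - 1"] unfolding is_perm_def entry_def by auto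
  then show ?thesis using assms by auto
qed

lemma entry_onto:
  assumes "is_perm p" "v \<in> {1..length p}" obtains i where "i \<in> {1..length p}" "entry p i = v"
proof -
  have "v \<in> set p" using assms unfolding is_perm_def by simp
  then obtain k where "k < length p" "p ! k = v" by (auto simp: in_set_conv_nth)
  then show ?thesis by (intro that[of "k + 1"]) (auto simp: entry_def)
qed

lemma entry_inv_perm:
  assumes "is_perm p" "j \<in> {1..length p}" shows "entry (inv_perm p) (entry p j) = j"
proof -
  have v: "entry p j \<in> {1..length p}" by (rule entry_in[OF assms])
  have "entry (inv_perm p) (entry p j) = (THE i. i \<in> {1..length p} \<and> entry p i = entry p j)"
  proof -
    have "entry p j - 1 < length p" "[1..<length p + 1] ! (entry p j - 1) = entry p j"
      using v nth_upt[of 1 "entry p j - 1" "length p + 1"] by (auto simp del: upt_Suc)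
    then show ?thesis unfolding inv_perm_def entry_def[of "map _ _"]
      using assms(2) by (subst nth_map) (cases p, auto simp del: upt_Suc)
  qed
  also have "\<dots> = j" using assms by (intro the_equality) (auto dest: entry_inj)
  finally show ?thesis .
qed

lemma length_inv_perm [simp]: "length (inv_perm p) = length p"
  unfolding inv_perm_def by (simp del: upt_Suc)

text \<open>
  Since odd entries sit at odd positions, the position \<open>q\<close> of an odd entry and its value
  are halved in the same way; this expresses the inverse of the odd part by positions in \<open>b\<close>.
\<close>
lemma odd_part_of_parity_perm:
  assumes "parity_perm b"
  defines "a \<equiv> induced odd b"
  shows "length a = (length b + 1) div 2"
    and "j \<in> {1..(length b + 1) div 2} \<Longrightarrow> entry a j = (entry b (2 * j - 1) + 1) div 2"
    and "is_perm a"
    and "q \<in> {1..length b} \<Longrightarrow> odd q \<Longrightarrow> entry (inv_perm a) ((entry b q + 1) div 2) = (q + 1) div 2"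
proof -
  let ?M = "(length b + 1) div 2"
  have b: "is_perm b" "odd (length b)" "\<And>i. i \<in> {1..length b} \<Longrightarrow> even (entry b i) \<longleftrightarrow> even i"
    using assms unfolding parity_perm_def by auto
  have "odd (b ! i) \<longleftrightarrow> even i" if "i < length b" for i
    using b(3)[of "i + 1"] that unfolding entry_def by auto
  then have a: "a = map (\<lambda>j. (b ! (2 * j) + 1) div 2) [0..<?M]"
    unfolding a_def induced_odd[OF b(1)] by (subst filter_odd_alternate) auto
  show len: "length a = ?M" unfolding a by simp
  have ent: "entry a j = (entry b (2 * j - 1) + 1) div 2" if "j \<in> {1..?M}" for j
  proof -
    have "2 * j - 1 - 1 = 2 * (j - 1)" by simp
    moreover have "j - 1 < ?M" using that by auto
    ultimately show ?thesis unfolding entry_def a by simp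
  qed
  show "entry a j = (entry b (2 * j - 1) + 1) div 2" if "j \<in> {1..?M}" for j using ent[OF that] .
  have pos: "2 * j - 1 \<in> {1..length b}" "odd (2 * j - 1)" if "j \<in> {1..?M}" for j
    using that b(2) by (auto elim!: oddE)
  show perm: "is_perm a"
  proof -
    have inj: "i = j" if "i \<in> {1..?M}" "j \<in> {1..?M}" "entry a i = entry a j" for i j
    proof -
      have "odd (entry b (2 * i - 1))" "odd (entry b (2 * j - 1))" using b(3) pos that by auto
      then have "entry b (2 * i - 1) = entry b (2 * j - 1)"
        using that ent by (auto elim!: oddE)
      then have "2 * i - 1 = 2 * j - 1" using entry_inj[OF b(1)] pos that by blast
      then show ?thesis using that by auto
    qed
    have dist: "distinct a"
      unfolding distinct_conv_nth
    proof (intro allI impI)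
      fix i j assume "i < length a" "j < length a" "i \<noteq> j"
      then show "a ! i \<noteq> a ! j" using inj[of "i + 1" "j + 1"] len unfolding entry_def by auto
    qed
    have "set a \<subseteq> {1..?M}"
    proof
      fix v assume "v \<in> set a"
      then obtain k where k: "k < ?M" "a ! k = v" using len by (auto simp: in_set_conv_nth)
      then have "k + 1 \<in> {1..?M}" "entry a (k + 1) = v" unfolding entry_def by auto
      then have "v = (entry b (2 * (k + 1) - 1) + 1) div 2" "entry b (2 * (k + 1) - 1) \<in> {1..length b}"
        using ent entry_in[OF b(1)] pos by metis+
      then show "v \<in> {1..?M}" by auto
    qed
    then have "set a = {1..?M}"
      using distinct_card[OF dist] len by (intro card_subset_eq) auto
    then show ?thesis unfolding is_perm_def using dist len by simp
  qed
  show "entry (inv_perm a) ((entry b q + 1) div 2) = (q + 1) div 2" if "q \<in> {1..length b}" "odd q" for q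
  proof -
    have q: "(q + 1) div 2 \<in> {1..?M}" "2 * ((q + 1) div 2) - 1 = q" using that by (auto elim!: oddE)
    then have "entry a ((q + 1) div 2) = (entry b q + 1) div 2" using ent by metis
    then show ?thesis using entry_inv_perm[OF perm, of "(q + 1) div 2"] q len by metis
  qed
qed

lemma entry_fun_entry: "1 \<le> x \<Longrightarrow> entry_fun b (int x) = int (entry b x)"
  unfolding entry_fun_def entry_def by (simp add: nat_diff_distrib)

lemma is_perm_iff_bij:
  "is_perm b \<longleftrightarrow> bij_betw (entry_fun b) {0<..int (length b)} {0<..int (length b)}" (is "_ \<longleftrightarrow> ?bij")
proof
  assume b: "is_perm b"
  show ?bij
  proof (rule bij_betwI')
    fix x y assume xy: "x \<in> {0<..int (length b)}" "y \<in> {0<..int (length b)}"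
    define x' y' where "x' = nat x" and "y' = nat y"
    have x': "x = int x'" "x' \<in> {1..length b}" and y': "y = int y'" "y' \<in> {1..length b}"
      using xy unfolding x'_def y'_def by auto
    then show "entry_fun b x = entry_fun b y \<longleftrightarrow> x = y"
      using entry_inj[OF b, of x' y'] by (auto simp: entry_fun_entry)
    show "entry_fun b x \<in> {0<..int (length b)}"
      using entry_in[OF b x'(2)] x' by (simp add: entry_fun_entry)
  next
    fix w assume "w \<in> {0<..int (length b)}"
    then have "nat w \<in> {1..length b}" "w = int (nat w)" by auto
    then obtain i where "i \<in> {1..length b}" "entry b i = nat w" using entry_onto[OF b] by metis
    then show "\<exists>x\<in>{0<..int (length b)}. w = entry_fun b x"
      using \<open>w = int (nat w)\<close> entry_fun_entry[of i b] by (intro bexI[of _ "int i"]) auto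
  qed
next
  assume bij: ?bij
  have nth: "b ! k = nat (entry_fun b (int k + 1))" for k unfolding entry_fun_def by simp
  have "distinct b"
    unfolding distinct_conv_nth
  proof (intro allI impI)
    fix i j assume ij: "i < length b" "j < length b" "i \<noteq> j"
    then have "entry_fun b (int i + 1) \<noteq> entry_fun b (int j + 1)"
      using bij unfolding bij_betw_def inj_on_def by force
    then show "b ! i \<noteq> b ! j" unfolding entry_fun_def by simp
  qed
  moreover have "set b \<subseteq> {1..length b}"
  proof
    fix v assume "v \<in> set b"
    then obtain k where k: "k < length b" "b ! k = v" by (auto simp: in_set_conv_nth)
    then have "entry_fun b (int k + 1) \<in> {0<..int (length b)}" using bij unfolding bij_betw_def by auto
    then show "v \<in> {1..length b}" using k unfolding entry_fun_def by auto
  qed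
  ultimately have "set b = {1..length b}"
    by (intro card_subset_eq) (simp_all add: distinct_card)
  then show "is_perm b" unfolding is_perm_def using \<open>distinct b\<close> by simp
qed

text \<open>
  The Baxter conditions for \<open>v - 1, v\<close> and \<open>v, v + 1\<close> force the neighbouring values of an even
  entry \<open>v\<close> to opposite sides.  The orientation then decides whether the odd entries left
  and right of it ascend, and whether the odd values below and above it occur in increasing
  order; alternation of the odd part and of its inverse fixes the residues of its position
  and of \<open>v\<close>.
\<close>
lemma snow_list_if_baxter:
  assumes cb: "complete_Baxter b" and len: "length b mod 4 = 3" and da: "doubly_alternating (induced odd b)"
  shows "snow_list b"
proof -
  let ?N = "length b" and ?F = "entry_fun b" and ?a = "induced odd b"
  have perm: "is_perm b" and par: "\<And>i. i \<in> {1..?N} \<Longrightarrow> even (entry b i) \<longleftrightarrow> even i"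
    using cb unfolding complete_Baxter_def by auto
  have odd_len: "odd ?N" using len by presburger
  have pp: "parity_perm b" using perm par odd_len unfolding parity_perm_def by simp
  note a = odd_part_of_parity_perm[OF pp]
  have bax: "(odd (entry b x) \<longrightarrow> entry b z < entry b x) \<and> (even (entry b x) \<longrightarrow> entry b z > entry b x + 1)"
    if "x \<in> {1..?N}" "y \<in> {1..?N}" "entry b y = entry b x + 1" "x < z \<and> z < y \<or> y < z \<and> z < x" for x y z
    using cb that unfolding complete_Baxter_def by metis
  have key: "windmill {0<..0 + int ?N} ?F (int p)" if p: "p \<in> {1..?N}" "even p" for p
  proof -
    define v where "v = entry b p"
    have v: "v \<in> {1..?N}" "even v" using entry_in[OF perm p(1)] par p unfolding v_def by auto
    then have "v - 1 \<in> {1..?N}" "v + 1 \<in> {1..?N}" using odd_len by (auto elim!: evenE oddE)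
    note v1N = this
    obtain y where y: "y \<in> {1..?N}" "entry b y = v - 1" by (rule entry_onto[OF perm v1N(1)])
    obtain y' where y': "y' \<in> {1..?N}" "entry b y' = v + 1" by (rule entry_onto[OF perm v1N(2)])
    have v1: "entry b p = entry b y + 1" "odd (entry b y)" using v y unfolding v_def[symmetric] by auto
    have lo: "entry b z < v - 1" if "y < z \<and> z < p \<or> p < z \<and> z < y" for z
      using bax[OF y(1) p(1) v1(1) that] v1(2) y(2) by simp
    have hi: "entry b z > v + 1" if "p < z \<and> z < y' \<or> y' < z \<and> z < p" for z
      using bax[OF p(1) y'(1) _ that] y'(2) v unfolding v_def by simp
    have ne: "y \<noteq> p" "y' \<noteq> p" "y \<noteq> y'" using y y' v unfolding v_def by auto
    \<comment> \<open>two neighbouring values on the same side would contradict \<open>lo\<close> or \<open>hi\<close>\<close>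
    have sides: "y < p \<and> p < y' \<or> y' < p \<and> p < y"
    proof (rule ccontr)
      assume "\<not> ?thesis"
      then consider "y < y' \<and> y' < p \<or> p < y' \<and> y' < y" | "p < y \<and> y < y' \<or> y' < y \<and> y < p"
        using ne by linarith
      then show False using lo[of y'] hi[of y] y y' by cases auto
    qed
    have pN: "p + 1 \<in> {1..?N}" "p - 1 \<in> {1..?N}" using p odd_len by (auto elim!: evenE oddE)
    have lo': "entry b z < v" if "y \<le> z \<and> z < p \<or> p < z \<and> z \<le> y" for z
      using lo[of z] y that v by (cases "z = y") auto
    have hi': "entry b z > v" if "p < z \<and> z \<le> y' \<or> y' \<le> z \<and> z < p" for z
      using hi[of z] y' that by (cases "z = y'") auto
    have asc: "y < p \<longleftrightarrow> entry b (p - 1) < entry b (p + 1)"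
      using sides lo'[of "p - 1"] lo'[of "p + 1"] hi'[of "p - 1"] hi'[of "p + 1"] p by force
    have j: "p div 2 \<in> {1..(?N + 1) div 2}" "p div 2 + 1 \<in> {1..(?N + 1) div 2}"
      using p pN by (auto elim!: evenE)
    have e: "entry ?a (p div 2) = (entry b (p - 1) + 1) div 2" "entry ?a (p div 2 + 1) = (entry b (p + 1) + 1) div 2"
      using a(2)[OF j(1)] a(2)[OF j(2)] p(2) by auto
    have odds: "odd (entry b (p - 1))" "odd (entry b (p + 1))" using par pN p by auto
    have alt: "alternating ?a" "alternating (inv_perm ?a)" using da unfolding doubly_alternating_def by auto
    have jj: "1 \<le> p div 2 \<and> p div 2 < length ?a" using j a(1) by auto
    \<comment> \<open>\<open>ori\<close> uses alternation of the odd part, \<open>ori_inv\<close> that of its inverse; together they compare residues\<close>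
    have ori: "y < p \<longleftrightarrow> odd (p div 2)"
      unfolding asc using alt(1) jj e odds unfolding alternating_def by (auto elim!: oddE)
    have odds': "odd y" "odd y'" using par[OF y(1)] v1(2) par[OF y'(1)] y'(2) v(2) by auto
    have i: "entry (inv_perm ?a) (v div 2) = (y + 1) div 2" "entry (inv_perm ?a) (v div 2 + 1) = (y' + 1) div 2"
      using a(4)[OF y(1) odds'(1)] a(4)[OF y'(1) odds'(2)] y y' v by (auto elim!: evenE)
    have "1 \<le> v div 2 \<and> v div 2 < length (inv_perm ?a)" using v a(1) odd_len by (auto elim!: evenE oddE)
    then have ori_inv: "y < y' \<longleftrightarrow> odd (v div 2)"
      using alt(2) i odds' unfolding alternating_def by (auto elim!: oddE)
    have F: "?F (int p) = int v" "?F (int y) = int v - 1" "?F (int y') = int v + 1"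
      using p y y' v by (auto simp: entry_fun_entry v_def)
    have loF: "?F z < ?F (int p)" if "int y < z \<and> z < int p \<or> int p < z \<and> z < int y" for z
    proof -
      define k where "k = nat z"
      have z: "z = int k" using that unfolding k_def by auto
      show ?thesis using lo'[of k] that F entry_fun_entry[of k b] unfolding z by auto
    qed
    have hiF: "?F (int p) < ?F z" if "int y' < z \<and> z < int p \<or> int p < z \<and> z < int y'" for z
    proof -
      define k where "k = nat z"
      have z: "z = int k" using that unfolding k_def by auto
      show ?thesis using hi'[of k] that F entry_fun_entry[of k b] unfolding z by auto
    qed
    have "int v mod 4 = int p mod 4" using sides ori ori_inv v(2) p(2) by presburger
    moreover have "rising {0<..0 + int ?N} ?F (int p)" if "int p mod 4 = 2"
    proof -
      have "odd (p div 2)" using that by presburger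
      then have "y < p" "p < y'" using ori sides by auto
      then show ?thesis using loF hiF F y y' by (intro risingI[of "int y" _ _ _ "int y'"]) auto
    qed
    moreover have "falling {0<..0 + int ?N} ?F (int p)" if "int p mod 4 = 0"
    proof -
      have "even (p div 2)" using that by presburger
      then have "p < y" "y' < p" using ori sides by auto
      then show ?thesis using loF hiF F y y' by (intro fallingI[of "int y" _ _ _ "int y'"]) auto
    qed
    ultimately show ?thesis using F v p unfolding windmill_def by simp
  qed
  have "windmill {0<..0 + int ?N} ?F x" if "x \<in> {0<..0 + int ?N}" for x
  proof -
    define p where "p = nat x"
    have p: "x = int p" "p \<in> {1..?N}" using that unfolding p_def by auto
    show ?thesis
    proof (cases "even p")
      case True
      then show ?thesis using key p by simp
    next
      case False
      then have "odd x" "odd (?F x)" using par[OF p(2)] p by (auto simp: entry_fun_entry)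
      then show ?thesis unfolding windmill_def using even_mod_4 by auto
    qed
  qed
  then show ?thesis using perm len unfolding snow_list_def snow_box_def is_perm_iff_bij by simp
qed

lemma baxter_if_snow_list:
  assumes "snow_list b"
  shows "complete_Baxter b" "doubly_alternating (induced odd b)"
proof -
  let ?N = "length b" and ?F = "entry_fun b" and ?a = "induced odd b"
  have len: "?N mod 4 = 3" and box: "snow_box 0 0 (int ?N) ?F" using assms unfolding snow_list_def by auto
  have perm: "is_perm b" using box unfolding is_perm_iff_bij snow_box_def by simp
  have odd_len: "odd ?N" using len by presburger
  have wm: "windmill {0<..0 + int ?N} ?F (int p)" if "p \<in> {1..?N}" for p
    using snow_box_windmill[OF box, of "int p"] that by simp
  have par: "even (entry b p) \<longleftrightarrow> even p" if "p \<in> {1..?N}" for p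
    using wm[OF that] that unfolding windmill_def by (simp add: entry_fun_entry)
  have pp: "parity_perm b" using perm par odd_len unfolding parity_perm_def by simp
  note a = odd_part_of_parity_perm[OF pp]
  show "complete_Baxter b"
    unfolding complete_Baxter_def
  proof (intro conjI perm odd_len ballI allI impI par)
    fix x y z i
    assume x: "x \<in> {1..?N}" and y: "y \<in> {1..?N}" and xi: "entry b x = i" "entry b y = i + 1"
      and z: "x < z \<and> z < y \<or> y < z \<and> z < x"
    have z1: "z \<in> {1..?N}" using x y z by auto
    have F: "?F (int x) = int i" "?F (int y) = int i + 1" "?F (int z) = int (entry b z)"
      using x y z1 xi by (auto simp: entry_fun_entry)
    have mem: "int x \<in> {0<..0 + int ?N}" "int y \<in> {0<..0 + int ?N}" using x y by auto
    have nz: "entry b z \<noteq> i" "entry b z \<noteq> i + 1" using entry_inj[OF perm z1 x] entry_inj[OF perm z1 y] z xi by auto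
    show "entry b z < i" if "odd i"
      using between_arm(1)[OF box mem(2,1), of "int z"] par[OF y] xi that z F nz by auto
    show "i + 1 < entry b z" if "even i"
      using between_arm(2)[OF box mem(1,2), of "int z"] par[OF x] xi that z F nz by auto
  qed
  have alt1: "alternating ?a"
    unfolding alternating_def
  proof (intro allI impI)
    fix j assume j: "1 \<le> j \<and> j < length ?a"
    define p where "p = 2 * j"
    have p: "p \<in> {1..?N}" "p - 1 \<in> {1..?N}" "p + 1 \<in> {1..?N}" using j odd_len unfolding p_def a(1) atLeastAtMost_iff by presburger+
    have e: "entry ?a j = (entry b (p - 1) + 1) div 2" "entry ?a (j + 1) = (entry b (p + 1) + 1) div 2"
      using a(2)[of j] a(2)[of "j + 1"] j unfolding p_def a(1) by auto
    have odds: "odd (entry b (p - 1))" "odd (entry b (p + 1))" using par[OF p(2)] par[OF p(3)] p(1) unfolding p_def by auto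
    have F: "?F (int p - 1) = int (entry b (p - 1))" "?F (int p + 1) = int (entry b (p + 1))"
      using entry_fun_entry[of "p - 1" b] entry_fun_entry[of "p + 1" b] p by (simp_all add: of_nat_diff add.commute)
    have "entry b (p - 1) < entry b (p + 1)" if "odd j"
    proof -
      have "int p mod 4 = 2" using that unfolding p_def by presburger
      then have "rising {0<..0 + int ?N} ?F (int p)" using wm[OF p(1)] unfolding windmill_def by simp
      from rising_neighbours[OF this] show ?thesis using F by simp
    qed
    moreover have "entry b (p - 1) > entry b (p + 1)" if "even j"
    proof -
      have "int p mod 4 = 0" using that unfolding p_def by presburger
      then have "falling {0<..0 + int ?N} ?F (int p)" using wm[OF p(1)] unfolding windmill_def by simp
      from falling_neighbours[OF this] show ?thesis using F by simp
    qed
    ultimately show "(odd j \<longrightarrow> entry ?a j < entry ?a (j + 1)) \<and> (even j \<longrightarrow> entry ?a j > entry ?a (j + 1))"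
      using e odds by (auto elim!: oddE)
  qed
  have alt2: "alternating (inv_perm ?a)"
    unfolding alternating_def
  proof (intro allI impI)
    fix k assume k: "1 \<le> k \<and> k < length (inv_perm ?a)"
    then have v: "2 * k \<in> {1..?N}" "2 * k - 1 \<in> {1..?N}" "2 * k + 1 \<in> {1..?N}"
      using odd_len a(1) by (auto elim!: oddE)
    obtain p where p: "p \<in> {1..?N}" "entry b p = 2 * k" by (rule entry_onto[OF perm v(1)])
    obtain q where q: "q \<in> {1..?N}" "entry b q = 2 * k - 1" by (rule entry_onto[OF perm v(2)])
    obtain s where s: "s \<in> {1..?N}" "entry b s = 2 * k + 1" by (rule entry_onto[OF perm v(3)])
    have par': "even p" "odd q" "odd s" using par[OF p(1)] par[OF q(1)] par[OF s(1)] p q s k by auto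
    have i: "entry (inv_perm ?a) k = (q + 1) div 2" "entry (inv_perm ?a) (k + 1) = (s + 1) div 2"
      using a(4)[OF q(1) par'(2)] a(4)[OF s(1) par'(3)] q s k by auto
    have F: "?F (int p) = 2 * int k" "?F (int q) = 2 * int k - 1" "?F (int s) = 2 * int k + 1"
      using p q s k by (auto simp: entry_fun_entry of_nat_diff)
    have inj: "x = int y" if "?F x = ?F (int y)" "x \<in> {0<..0 + int ?N}" "y \<in> {1..?N}" for x y
      using snow_box_inj[OF box that(2) _ that(1)] that(3) by simp
    have m: "2 * int k mod 4 = int p mod 4" using wm[OF p(1)] F par' unfolding windmill_def by simp
    have "q < s" if "odd k"
    proof -
      have "int p mod 4 = 2" using that m by presburger
      then have "rising {0<..0 + int ?N} ?F (int p)" using wm[OF p(1)] unfolding windmill_def by simp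
      then obtain x y where "x \<in> {0<..0 + int ?N}" "x < int p" "?F x = ?F (int p) - 1"
        "y \<in> {0<..0 + int ?N}" "int p < y" "?F y = ?F (int p) + 1" by (rule risingE) blast
      then show ?thesis using inj[of x q] inj[of y s] F q s by simp
    qed
    moreover have "s < q" if "even k"
    proof -
      have "int p mod 4 = 0" using that m by presburger
      then have "falling {0<..0 + int ?N} ?F (int p)" using wm[OF p(1)] unfolding windmill_def by simp
      then obtain x y where "x \<in> {0<..0 + int ?N}" "int p < x" "?F x = ?F (int p) - 1"
        "y \<in> {0<..0 + int ?N}" "y < int p" "?F y = ?F (int p) + 1" by (rule fallingE) blast
      then show ?thesis using inj[of x q] inj[of y s] F q s by simp
    qed
    ultimately show "(odd k \<longrightarrow> entry (inv_perm ?a) k < entry (inv_perm ?a) (k + 1)) \<and>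
        (even k \<longrightarrow> entry (inv_perm ?a) k > entry (inv_perm ?a) (k + 1))"
      using i par' by (auto elim!: oddE)
  qed
  show "doubly_alternating ?a" unfolding doubly_alternating_def using a(3) alt1 alt2 by simp
qed


section \<open>Even and odd threads\<close>

lemma skew_assoc: "skew (skew x y) z = skew x (skew y z)"
  unfolding skew_def by (simp add: add.assoc o_def)

lemma skew_one: "skew [Suc 0] y = Suc (length y) # y" "skew e [Suc 0] = map Suc e @ [Suc 0]"
  unfolding skew_def by (simp_all add: fun_eq_iff)

lemma is_permD: "is_perm p \<Longrightarrow> x \<in> set p \<Longrightarrow> 1 \<le> x \<and> x \<le> length p"
  unfolding is_perm_def by auto

lemma is_perm_Nil [simp]: "is_perm []" and is_perm_one [simp]: "is_perm [Suc 0]"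
  unfolding is_perm_def by auto

lemma is_perm_skew: "is_perm x \<Longrightarrow> is_perm y \<Longrightarrow> is_perm (skew x y)"
  unfolding is_perm_def skew_def by (auto simp: distinct_map)

lemma is_perm_compl:
  assumes "is_perm p" shows "is_perm (compl p)"
proof -
  have "bij_betw (\<lambda>v. length p + 1 - v) {1..length p} {1..length p}"
    by (rule bij_betwI[where g = "\<lambda>v. length p + 1 - v"]) auto
  then have "(\<lambda>v. length p + 1 - v) ` {1..length p} = {1..length p}"
    "inj_on (\<lambda>v. length p + 1 - v) {1..length p}" by (auto simp: bij_betw_def)
  then show ?thesis using assms unfolding is_perm_def compl_def by (simp add: distinct_map)
qed

lemma compl_compl: assumes "is_perm p" shows "compl (compl p) = p"
proof -
  have "length p + 1 - (length p + 1 - v) = v" if "v \<in> set p" for v using is_permD[OF assms that] by auto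
  then show ?thesis unfolding compl_def by (auto intro: map_idI)
qed

lemma is_perm_frame: "a = Anti \<or> (\<exists>p. a = Perm p \<and> is_perm p) \<Longrightarrow> is_perm (frame a)"
proof (elim disjE exE conjE)
  fix p assume "a = Perm p" "is_perm p"
  then show "is_perm (frame a)" using is_perm_compl[of p]
    unfolding is_perm_def by (auto simp: distinct_map)
qed simp

lemma is_perm_lead: "a = Anti \<or> (\<exists>p. a = Perm p \<and> is_perm p) \<Longrightarrow> is_perm (lead a)"
  by (auto intro!: is_perm_skew)

text \<open>
  $c(1 \oplus c(p) \oplus 1) = 1 \ominus p \ominus 1$.
\<close>
lemma compl_frame:
  assumes "is_perm p" shows "compl (frame (Perm p)) = skew [1] (skew p [1])"
proof -
  have "map (\<lambda>v. length p + 3 - Suc v) (compl p) = map (\<lambda>v. Suc (length p + 1 - v)) (compl p)"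
  proof (intro map_cong refl)
    fix v assume "v \<in> set (compl p)"
    then show "length p + 3 - Suc v = Suc (length p + 1 - v)"
      using is_permD[OF is_perm_compl[OF assms]] by fastforce
  qed
  also have "\<dots> = map Suc (compl (compl p))" by (simp add: compl_def[of "compl p"])
  finally show ?thesis unfolding compl_compl[OF assms] compl_def[of "frame (Perm p)"]
    by (simp add: skew_one o_def numeral_3_eq_3)
qed

fun snow_of :: "shape \<Rightarrow> aperm" where
  "snow_of Leaf = Anti"
| "snow_of (Node l r) = Perm (skew (frame (snow_of l)) (lead (snow_of r)))"

text \<open>
  The parities inside a frame are exchanged, because its complement part is shifted by
  one position; hence the two parts of $(1 \oplus c(\pi_1) \oplus 1) \ominus 1 \ominus \pi_2$
  refer to opposite parts of $\pi_1$ and to the same parts of $\pi_2$.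
\<close>
fun even_of :: "shape \<Rightarrow> aperm" and odd_of :: "shape \<Rightarrow> nat list" where
  "even_of Leaf = Anti"
| "even_of (Node l r) = Perm (skew (compl (odd_of l)) (lead (even_of r)))"
| "odd_of Leaf = []"
| "odd_of (Node l r) = skew (frame (even_of l)) (odd_of r)"

lemma snow_of_perm: "snow_of t = Anti \<or> (\<exists>p. snow_of t = Perm p \<and> is_perm p)"
  by (induction t) (auto intro!: is_perm_skew is_perm_frame is_perm_lead simp del: frame.simps lead.simps)

lemma thread_perm: "even_of t = Anti \<or> (\<exists>p. even_of t = Perm p \<and> is_perm p)" "is_perm (odd_of t)"
  by (induction t) (auto intro!: is_perm_skew is_perm_frame is_perm_lead is_perm_compl simp del: frame.simps lead.simps)

lemma even_of_perm: "even_of t = Perm p \<Longrightarrow> is_perm p"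
  using thread_perm(1)[of t] by auto

lemma snow_list_odd: "snow_list b \<Longrightarrow> odd (length b)"
proof -
  assume "snow_list b"
  then have "length b mod 4 = 3" unfolding snow_list_def by simp
  then show ?thesis by presburger
qed

lemma length_filter_even: "is_perm p \<Longrightarrow> length (filter even p) = length p div 2"
proof -
  assume p: "is_perm p"
  have "set (filter even p) = {y. 1 \<le> y \<and> even y \<and> y \<le> length p}" using p unfolding is_perm_def by auto
  then show ?thesis using distinct_card[of "filter even p"] p card_even_upto unfolding is_perm_def by simp
qed

lemma length_filter_odd: "is_perm p \<Longrightarrow> length (filter odd p) = (length p + 1) div 2"
proof -
  assume p: "is_perm p"
  have "set (filter odd p) = {y. 1 \<le> y \<and> odd y \<and> y \<le> length p}" using p unfolding is_perm_def by auto
  then show ?thesis using distinct_card[of "filter odd p"] p card_odd_upto unfolding is_perm_def by simp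
qed

lemma length_induced: 
  "is_perm p \<Longrightarrow> length (induced even p) = length p div 2"
  "is_perm p \<Longrightarrow> length (induced odd p) = (length p + 1) div 2"
  by (simp_all add: induced_even induced_odd length_filter_even length_filter_odd)

text \<open>
  The values of \<open>x\<close> are raised by an even number, so they keep their parity, and \<open>y\<close>
  contains equally many even and odd values.
\<close>
lemma induced_skew:
  assumes "is_perm x" "is_perm y" "even (length y)"
  shows "induced even (skew x y) = skew (induced even x) (induced even y)"
    "induced odd (skew x y) = skew (induced odd x) (induced odd y)"
proof -
  obtain k where k: "length y = 2 * k" using assms(3) by (elim evenE)
  have xy: "is_perm (skew x y)" by (rule is_perm_skew[OF assms(1,2)])
  have l: "length (filter even y) = k" "length (filter odd y) = k"
    using length_filter_even[OF assms(2)] length_filter_odd[OF assms(2)] k by auto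
  show "induced even (skew x y) = skew (induced even x) (induced even y)"
    using l unfolding induced_even[OF xy] induced_even[OF assms(1)] induced_even[OF assms(2)]
    by (simp add: skew_def k filter_map o_def)
  show "induced odd (skew x y) = skew (induced odd x) (induced odd y)"
    using l unfolding induced_odd[OF xy] induced_odd[OF assms(1)] induced_odd[OF assms(2)]
    by (simp add: skew_def k filter_map o_def)
qed

lemma induced_even_lead:
  assumes "is_perm p" "odd (length p)"
  shows "induced even (lead (Perm p)) = lead (Perm (induced even p))"
proof -
  have "is_perm (lead (Perm p))" using is_perm_lead assms by blast
  then show ?thesis using length_filter_even[OF assms(1)] assms
    by (simp add: induced_even skew_one)
qed

lemma induced_odd_lead:
  assumes "is_perm p" "odd (length p)"
  shows "induced odd (lead (Perm p)) = induced odd p"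
proof -
  have "is_perm (lead (Perm p))" using is_perm_lead assms by blast
  then show ?thesis using assms by (simp add: induced_odd skew_one)
qed

lemma induced_even_wide_frame:
  assumes p: "is_perm p" "odd (length p)" and perm: "is_perm (wide_frame (Perm p))"
  shows "induced even (wide_frame (Perm p)) = frame (Perm (induced even p))"
proof -
  obtain k where k: "length p = 2 * k + 1" using p(2) by (elim oddE)
  have b: "1 \<le> v \<and> v \<le> 2 * k + 1" if "v \<in> set p" for v using is_permD[OF p(1) that] k by simp
  have l: "length (filter even p) = k" using length_filter_even[OF p(1)] k by simp
  have "even (2 + (2 * k + 1 + 1 - v)) \<longleftrightarrow> even v" if "v \<in> set p" for v
    using b[OF that] by presburger
  then have ev: "filter (\<lambda>v. even (2 + (2 * k + 1 + 1 - v))) p = filter even p"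
    by (intro filter_cong) auto
  have "(2 + (2 * k + 1 + 1 - v)) div 2 = Suc (k + 1 - v div 2)" if "v \<in> set p" "even v" for v
    using b[OF that(1)] that(2) by presburger
  then have "map (\<lambda>v. (2 + (2 * k + 1 + 1 - v)) div 2) (filter even p) =
      map (\<lambda>v. Suc (k + 1 - v div 2)) (filter even p)"
    by (intro map_cong refl) simp
  then show ?thesis using ev l unfolding induced_even[OF perm] induced_even[OF p(1)]
    by (simp add: compl_def k filter_map o_def)
qed

lemma induced_frame:
  assumes p: "is_perm p" "odd (length p)"
  shows "induced even (frame (Perm p)) = compl (induced odd p)"
    "induced odd (frame (Perm p)) = frame (Perm (induced even p))"
proof -
  obtain k where k: "length p = 2 * k + 1" using p(2) by (elim oddE)
  have b: "1 \<le> v \<and> v \<le> 2 * k + 1" if "v \<in> set p" for v using is_permD[OF p(1) that] k by simp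
  have l: "length (filter even p) = k" "length (filter odd p) = k + 1"
    using length_filter_even[OF p(1)] length_filter_odd[OF p(1)] k by simp_all
  have perm: "is_perm (frame (Perm p))" using is_perm_frame p by blast
  have "even (Suc (2 * k + 1 + 1 - v)) \<longleftrightarrow> odd v" if "v \<in> set p" for v
    using b[OF that] by presburger
  then have ev: "filter (\<lambda>v. even (Suc (2 * k + 1 + 1 - v))) p = filter odd p"
    "filter (\<lambda>v. odd (Suc (2 * k + 1 + 1 - v))) p = filter even p"
    by (intro filter_cong; auto)+
  have "Suc (2 * k + 1 + 1 - v) div 2 = k + 1 + 1 - (v + 1) div 2" if "v \<in> set p" "odd v" for v
    using b[OF that(1)] that(2) by presburger
  then have "map (\<lambda>v. Suc (2 * k + 1 + 1 - v) div 2) (filter odd p) =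
      map (\<lambda>v. k + 1 + 1 - (v + 1) div 2) (filter odd p)"
    by (intro map_cong refl) simp
  then show "induced even (frame (Perm p)) = compl (induced odd p)"
    using ev l unfolding induced_even[OF perm] induced_odd[OF p(1)]
    by (simp add: compl_def k filter_map o_def)
  have "(Suc (2 * k + 1 + 1 - v) + 1) div 2 = Suc (k + 1 - v div 2)" if "v \<in> set p" "even v" for v
    using b[OF that(1)] that(2) by presburger
  then have "map (\<lambda>v. (Suc (2 * k + 1 + 1 - v) + 1) div 2) (filter even p) =
      map (\<lambda>v. Suc (k + 1 - v div 2)) (filter even p)"
    by (intro map_cong refl) simp
  then show "induced odd (frame (Perm p)) = frame (Perm (induced even p))"
    using ev l unfolding induced_odd[OF perm] induced_even[OF p(1)]
    by (simp add: compl_def k filter_map o_def)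
qed

lemma snow_list_perm: "snow_list b \<Longrightarrow> is_perm b"
  using baxter_if_snow_list(1) unfolding complete_Baxter_def by blast

lemma even_part_baxter_of: "even_part (baxter_of t) = snow_of t"
proof (induction t)
  case (Node l r)
  have wf: "snow_list (wide_frame (baxter_of l))" by (rule snow_list_wide_frame[OF snow_list_baxter_of])
  have F: "induced even (wide_frame (baxter_of l)) = frame (snow_of l)"
  proof (cases "baxter_of l")
    case Anti
    then show ?thesis using Node(1) snow_list_perm[OF wf] by (simp add: induced_even)
  next
    case (Perm p)
    then have p: "snow_list p" using snow_list_baxter_of[of l] by auto
    have "snow_of l = Perm (induced even p)" using Node(1) Perm by simp
    then show ?thesis
      using induced_even_wide_frame[OF snow_list_perm[OF p] snow_list_odd[OF p]] snow_list_perm[OF wf]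
      unfolding Perm by simp
  qed
  have R: "is_perm (lead (baxter_of r)) \<and> even (length (lead (baxter_of r))) \<and>
      induced even (lead (baxter_of r)) = lead (snow_of r)"
  proof (cases "baxter_of r")
    case Anti
    then show ?thesis using Node(2) by (auto simp: induced_even)
  next
    case (Perm p)
    then have p: "snow_list p" using snow_list_baxter_of[of r] by auto
    have "snow_of r = Perm (induced even p)" using Node(2) Perm by simp
    then show ?thesis
      using induced_even_lead[OF snow_list_perm[OF p] snow_list_odd[OF p]]
        is_perm_lead[of "Perm p"] snow_list_perm[OF p] snow_list_odd[OF p]
      unfolding Perm by auto
  qed
  show ?case using induced_skew(1)[OF snow_list_perm[OF wf]] R F by simp
qed simp

lemma snow_of_odd: "snow_of t = Perm p \<Longrightarrow> odd (length p)"
proof -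
  assume t: "snow_of t = Perm p"
  then obtain b where b: "baxter_of t = Perm b" "induced even b = p"
    using even_part_baxter_of[of t] by (cases "baxter_of t") auto
  then have "snow_list b" using snow_list_baxter_of[of t] by auto
  then have "length p = length b div 2" "length b mod 4 = 3"
    using b length_induced(1)[OF snow_list_perm] unfolding snow_list_def by auto
  then show ?thesis by presburger
qed

lemma thread_parts_snow_of: "even_part (snow_of t) = even_of t \<and> odd_part (snow_of t) = Perm (odd_of t)"
proof (induction t)
  case (Node l r)
  have F: "is_perm (frame (snow_of l)) \<and> induced even (frame (snow_of l)) = compl (odd_of l) \<and>
      induced odd (frame (snow_of l)) = frame (even_of l)"
  proof (cases "snow_of l")
    case Anti
    then show ?thesis using Node(1) by (auto simp: induced_even induced_odd compl_def)
  next
    case (Perm p)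
    then have p: "is_perm p" "odd (length p)" using snow_of_perm[of l] snow_of_odd by auto
    have l: "even_of l = Perm (induced even p)" "odd_of l = induced odd p" using Node(1) Perm by simp_all
    then show ?thesis using induced_frame[OF p] is_perm_frame[of "Perm p"] p l
      unfolding Perm l by simp
  qed
  have R: "is_perm (lead (snow_of r)) \<and> even (length (lead (snow_of r))) \<and>
      induced even (lead (snow_of r)) = lead (even_of r) \<and> induced odd (lead (snow_of r)) = odd_of r"
  proof (cases "snow_of r")
    case Anti
    then show ?thesis using Node(2) by (auto simp: induced_even induced_odd)
  next
    case (Perm p)
    then have p: "is_perm p" "odd (length p)" using snow_of_perm[of r] snow_of_odd by auto
    have r: "even_of r = Perm (induced even p)" "odd_of r = induced odd p" using Node(2) Perm by simp_all
    then show ?thesis using induced_even_lead[OF p] induced_odd_lead[OF p] is_perm_lead[of "Perm p"] p r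
      unfolding Perm r by simp
  qed
  show ?case using induced_skew[of "frame (snow_of l)" "lead (snow_of r)"] F R by simp
qed (simp add: induced_def standardize_def)

lemma snow_leopard_odd_iff: "snow_leopard p \<and> odd (alength p) \<longleftrightarrow> (\<exists>t. p = snow_of t)"
proof
  assume p: "snow_leopard p \<and> odd (alength p)"
  show "\<exists>t. p = snow_of t"
  proof (cases p)
    case Anti
    then show ?thesis by (intro exI[of _ Leaf]) simp
  next
    case (Perm s)
    then obtain b where b: "complete_Baxter b" "length b = 2 * length s + 1"
      "induced even b = s" "doubly_alternating (induced odd b)" using p by auto
    have "odd (length s)" using p Perm by simp
    then have len: "length b mod 4 = 3" using b(2) by presburger
    then have "snow_list b" using snow_list_if_baxter b by blast
    then have "\<exists>t. baxter_of t = box_aperm 0 0 (int (length b)) (entry_fun b)"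
    proof (intro snow_box_shape)
      show "int (length b) mod 4 = 3" using len by presburger
    qed (auto simp: snow_list_def)
    then obtain t where t: "baxter_of t = box_aperm 0 0 (int (length b)) (entry_fun b)" ..
    have "box_list 0 0 (int (length b)) (entry_fun b) = b"
      by (rule nth_equalityI) (auto simp: box_list_def entry_fun_def nth_upto)
    then have "baxter_of t = Perm b" using t unfolding box_aperm_def by simp
    then have "snow_of t = p" using even_part_baxter_of[of t] b Perm by simp
    then show ?thesis by blast
  qed
next
  assume "\<exists>t. p = snow_of t"
  then obtain t where t: "p = snow_of t" ..
  show "snow_leopard p \<and> odd (alength p)"
  proof (cases p)
    case (Perm s)
    then obtain b where b: "baxter_of t = Perm b" "induced even b = s"
      using even_part_baxter_of[of t] t by (cases "baxter_of t") auto
    then have sl: "snow_list b" using snow_list_baxter_of[of t] by auto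
    then have "length s = length b div 2" "length b mod 4 = 3"
      using b length_induced(1)[OF snow_list_perm] unfolding snow_list_def by auto
    then have "length b = 2 * length s + 1" by presburger
    then show ?thesis using baxter_if_snow_list[OF sl] b Perm snow_of_odd t by auto
  qed simp
qed

text \<open>
  Subtrees can be chosen freely, so even and odd threads are closed under the formation rules
  of \<open>even_of\<close> and \<open>odd_of\<close>.
\<close>
lemma thread_sets: "even_threads = range even_of" "odd_threads = range (\<lambda>t. Perm (odd_of t))"
proof -
  have *: "{f p | p. \<exists>t. p = snow_of t} = range (\<lambda>t. f (snow_of t))" for f :: "aperm \<Rightarrow> aperm"
    by auto
  show "even_threads = range even_of" "odd_threads = range (\<lambda>t. Perm (odd_of t))"
    unfolding even_threads_def odd_threads_def snow_leopard_odd_iff * by (simp_all add: thread_parts_snow_of)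
qed


section \<open>Janus threads\<close>

inductive_set janus :: "aperm set" where
  anti: "Anti \<in> janus"
| lead: "g \<in> janus \<Longrightarrow> Perm (lead g) \<in> janus"
| hook: "Perm p \<in> janus \<Longrightarrow> g \<in> janus \<Longrightarrow> Perm (skew (frame (Perm p)) (lead g)) \<in> janus"

text \<open>
  An odd thread is a skew sum of frames, and any sequence of frames of even threads is allowed.
\<close>
lemma odd_of_skew: "\<exists>t. odd_of t = skew (odd_of l) (odd_of r)"
proof (induction l)
  case Leaf
  show ?case by (intro exI[of _ r]) simp
next
  case (Node a b)
  then obtain t where "odd_of t = skew (odd_of b) (odd_of r)" by blast
  then have "odd_of (Node a t) = skew (odd_of (Node a b)) (odd_of r)" by (simp add: skew_assoc)
  then show ?case ..
qed

text \<open>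
  An even thread is $c(o_1) \ominus 1 \ominus \dots \ominus 1 \ominus c(o_k)$ for odd threads $o_i$;
  two such expressions can be chained.
\<close>
lemma even_of_skew_lead: "even_of l = Perm e \<Longrightarrow> \<exists>t. even_of t = Perm (skew e (lead (even_of r)))"
proof (induction l arbitrary: e)
  case (Node a b)
  have e: "e = skew (compl (odd_of a)) (lead (even_of b))" using Node.prems by simp
  show ?case
  proof (cases "even_of b")
    case Anti
    then show ?thesis using e by (intro exI[of _ "Node a r"]) simp
  next
    case (Perm e')
    then obtain t where "even_of t = Perm (skew e' (lead (even_of r)))" using Node.IH by blast
    then have "even_of (Node a t) = Perm (skew e (lead (even_of r)))"
      unfolding e Perm by (simp add: skew_assoc)
    then show ?thesis ..
  qed
qed simp

lemma frame_Cons: "\<exists>xs. frame a = 1 # xs"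
  by (cases a) auto

lemma nth_compl: "i < length p \<Longrightarrow> compl p ! i = length p + 1 - p ! i"
  unfolding compl_def by simp

lemma nth_skew: "i < length x \<Longrightarrow> skew x y ! i = x ! i + length y"
  unfolding skew_def by (simp add: nth_append)

lemma frame_nonempty: "0 < length (frame a)"
  by (cases a) auto

lemma hd_skew: "x \<noteq> [] \<Longrightarrow> hd (skew x y) = length y + hd x"
  unfolding skew_def by (simp add: hd_append hd_map)

lemma hd_skew_frame: "hd (skew (frame a) y) = length y + 1"
  using frame_Cons[of a] by (auto simp: hd_skew)

lemma frame_length_one: "length (frame a) = 1 \<Longrightarrow> a = Anti"
  by (cases a) auto

lemma last_frame: "last (frame a) = length (frame a)" "frame a ! (length (frame a) - 1) = length (frame a)"
  by (cases a; simp add: nth_append)+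

text \<open>
  A frame starts with its least value, so it can start a skew sum with the greatest value only
  if it is a single entry.
\<close>
lemma skew_frame_eq_lead:
  assumes "skew (frame a) y = skew [1] z" shows "a = Anti" "y = z"
proof -
  have "hd (skew (frame a) y) = hd (skew [1] z)" using assms by simp
  then have len: "length y = length z" unfolding hd_skew_frame by (simp add: hd_skew)
  moreover have "length (skew (frame a) y) = length (skew [1] z)" using assms by simp
  ultimately have "length (frame a) = 1" by (simp del: frame.simps)
  then show "a = Anti" by (rule frame_length_one)
  then show "y = z" using assms by (simp add: skew_one)
qed

lemma odd_of_eq_lead:
  assumes "odd_of t = skew [1] y" shows "\<exists>u. odd_of u = y"
proof (cases t)
  case Leaf
  then have "length (skew [1] y) = 0" using assms by (metis list.size(3) odd_of.simps(1))
  then show ?thesis by simp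
next
  case (Node a r)
  then show ?thesis using skew_frame_eq_lead(2)[of "even_of a" "odd_of r" y] assms by auto
qed

text \<open>
  A frame ends with its greatest value, so a final 1 that is detached from all other
  entries is a frame of its own and can be removed.
\<close>
lemma odd_of_eq_trail: "odd_of t = skew e [1] \<Longrightarrow> \<exists>u. odd_of u = e"
proof (induction t arbitrary: e)
  case Leaf
  then have "length (skew e [1]) = 0" by (metis list.size(3) odd_of.simps(1))
  then show ?case by simp
next
  case (Node a b)
  let ?f = "frame (even_of a)"
  have eq: "map ((+) (length (odd_of b))) ?f @ odd_of b = map Suc e @ [1]"
  proof -
    have "skew ?f (odd_of b) = map Suc e @ [1]" using Node.prems by (simp add: skew_one del: frame.simps)
    then show ?thesis unfolding skew_def .
  qed
  show ?case
  proof (cases "odd_of b = []")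
    case True
    then have f: "?f = map Suc e @ [1]" using eq by (simp add: map_idI del: frame.simps)
    then have "length ?f = 1" using last_frame(1)[of "even_of a"] by simp
    then have "e = []" using f by (metis One_nat_def append_is_Nil_conv length_append_singleton length_map length_0_conv nat.inject)
    then show ?thesis by (intro exI[of _ Leaf]) simp
  next
    case False
    then have "last (odd_of b) = 1" "map ((+) (length (odd_of b))) ?f @ butlast (odd_of b) = map Suc e"
      using arg_cong[OF eq, of last] arg_cong[OF eq, of butlast] by (simp_all add: butlast_append)
    then obtain e1 e2 where e: "e = e1 @ e2" "map Suc e1 = map ((+) (length (odd_of b))) ?f"
      "map Suc e2 = butlast (odd_of b)" "last (odd_of b) = 1"
      by (metis map_eq_append_conv)
    have ob: "odd_of b = skew e2 [1]"
      using append_butlast_last_id[OF False] e by (simp add: skew_one)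
    then obtain u where u: "odd_of u = e2" using Node.IH(2) by blast
    have "length (odd_of b) = Suc (length e2)" using ob by simp
    then have "map Suc e1 = map Suc (map ((+) (length e2)) ?f)" using e(2) by (simp del: frame.simps)
    then have "e1 = map ((+) (length e2)) ?f" by (metis inj_map_eq_map inj_Suc)
    then have "odd_of (Node a u) = e" using e u by (simp add: skew_def)
    then show ?thesis ..
  qed
qed

lemma frame_even_of_positive: "i < length (frame (even_of t)) \<Longrightarrow> 1 \<le> frame (even_of t) ! i"
  using is_permD[OF is_perm_frame[OF thread_perm(1)] nth_mem] by blast

text \<open>
  Compare \<open>\<gamma>\<close> $= (1 \oplus c(e) \oplus 1) \ominus o$ with \<open>\<gamma>\<close> $= c(o') \ominus 1 \ominus e'$, where \<open>e\<close>, \<open>e'\<close>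
  are even and \<open>o\<close>, \<open>o'\<close> odd threads.  Let \<open>\<gamma>\<close> be nonempty.  If $o'$ is empty or a single frame, the second form shows that
  \<open>\<gamma>\<close> starts with its greatest value.  Then the first frame is 1, and
  the rest is a smaller permutation of both forms.  Otherwise $c(o')$ is a direct sum with a
  proper first summand, whose last entry is least.  Both the
  frame and $c(o')$ are skew indecomposable initial blocks, so they coincide.
  Hence the first frame of $o'$ is 1, the rest of $o'$ is $e \ominus 1$, and
  $o = 1 \ominus e'$.  Thus \<open>e\<close> and \<open>e'\<close> are both even threads and odd threads
  (or $e' = @$), and induction applies to them.
\<close>
lemma janus_if_threads:
  assumes "even_of t' = Perm \<gamma>" "odd_of t = \<gamma>"
  shows "Perm \<gamma> \<in> janus"
  using assms
proof (induction "length \<gamma>" arbitrary: \<gamma> t t' rule: less_induct)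
  case less
  show ?case
  proof (cases t)
    case Leaf
    then show ?thesis using less.prems janus.lead[OF janus.anti] by simp
  next
    case (Node l r)
    have g: "\<gamma> = skew (frame (even_of l)) (odd_of r)" using less.prems Node by simp
    obtain l' r' where t': "t' = Node l' r'" using less.prems by (cases t') auto
    have g': "\<gamma> = skew (compl (odd_of l')) (lead (even_of r'))" using less.prems t' by simp
    have hd: "hd \<gamma> = length (odd_of r) + 1" unfolding g by (rule hd_skew_frame)
    have len: "length \<gamma> = length (frame (even_of l)) + length (odd_of r)" unfolding g by simp
    have len': "length \<gamma> = length (odd_of l') + length (lead (even_of r'))" unfolding g' by simp
    show ?thesis
    proof (cases l')
      case Leaf
      then have gl: "\<gamma> = lead (even_of r')" using g' by (simp add: compl_def)
      have "\<gamma> \<noteq> []" using len frame_Cons[of "even_of l"] by auto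
      then obtain y where y: "even_of r' = Perm y" using gl by (cases "even_of r'") auto
      then have gy: "\<gamma> = skew [1] y" using gl by simp
      then obtain u where "odd_of u = y" using odd_of_eq_lead less.prems by blast
      then have "Perm y \<in> janus" using less.hyps[of y r' u] y gy by simp
      then show ?thesis using janus.lead[of "Perm y"] gy by simp
    next
      case l': (Node l1 l2)
      let ?O = "odd_of l'" and ?f = "frame (even_of l1)"
      have O: "?O = skew ?f (odd_of l2)" using l' by simp
      have Ope: "is_perm ?O" by (rule thread_perm(2))
      obtain xs where xs: "?f = 1 # xs" using frame_Cons by blast
      have One: "?O \<noteq> []" using O xs by (simp add: skew_def)
      have hdO: "hd (compl ?O) = length ?f"
      proof -
        have "hd (compl ?O) = length ?O + 1 - hd ?O" using One by (simp add: compl_def hd_map)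
        also have "\<dots> = length ?f" unfolding O hd_skew_frame by simp
        finally show ?thesis .
      qed
      have hd': "hd \<gamma> = length (lead (even_of r')) + length ?f"
        unfolding g' using hdO One by (subst hd_skew) (auto simp: compl_def)
      show ?thesis
      proof (cases "odd_of l2 = []")
        case True
        then have Of: "?O = ?f" using O by simp
        then have "length (frame (even_of l)) = 1" using hd hd' len len' by simp
        then have l: "even_of l = Anti" by (rule frame_length_one)
        have gr: "\<gamma> = skew [1] (odd_of r)" using g l by simp
        have "\<exists>t. even_of t = Perm (odd_of r)"
        proof (cases "even_of l1")
          case Anti
          then have "\<gamma> = skew [1] (lead (even_of r'))" using g' Of by (simp add: compl_def)
          then have "odd_of r = lead (even_of r')" using gr by (simp add: skew_one)
          then show ?thesis by (intro exI[of _ "Node Leaf r'"]) (simp add: compl_def)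
        next
          case (Perm e)
          then have "\<gamma> = skew (skew [1] (skew e [1])) (lead (even_of r'))"
            using g' Of compl_frame[OF even_of_perm[OF Perm]] by simp
          then have "odd_of r = skew e (skew [1] (lead (even_of r')))"
            using gr by (simp add: skew_assoc) (simp add: skew_one)
          moreover have "lead (even_of (Node Leaf r')) = skew [1] (lead (even_of r'))"
            by (simp add: compl_def)
          ultimately show ?thesis using even_of_skew_lead[OF Perm, of "Node Leaf r'"] by metis
        qed
        then obtain u where "even_of u = Perm (odd_of r)" ..
        then have "Perm (odd_of r) \<in> janus" using less.hyps[of "odd_of r" u r] gr by simp
        then show ?thesis using janus.lead[of "Perm (odd_of r)"] gr by simp
      next
        case False
        let ?a = "length (frame (even_of l))" and ?b = "length ?O" and ?h = "length ?f" and ?n = "length \<gamma>"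
        have b: "?b = ?h + length (odd_of l2)" using O by simp
        have abh: "?a + ?h = ?b + 1" using hd hd' len len' by simp
        have nth1: "\<gamma> ! i = frame (even_of l) ! i + (?n - ?a)" if "i < ?a" for i
        proof -
          have "\<gamma> ! i = frame (even_of l) ! i + length (odd_of r)"
            by (subst g) (rule nth_skew[OF that])
          then show ?thesis using len by linarith
        qed
        have nth2: "\<gamma> ! i = compl ?O ! i + (?n - ?b)" if "i < ?b" for i
        proof -
          have "i < length (compl ?O)" using that by simp
          then have "\<gamma> ! i = compl ?O ! i + length (lead (even_of r'))"
            by (subst g') (rule nth_skew)
          then show ?thesis using len' by linarith
        qed
        \<comment> \<open>the first summand of \<open>compl ?O\<close> is a single entry, so the two initial blocks have equal length\<close>
        have h1: "?h = 1"
        proof (rule ccontr)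
          assume "?h \<noteq> 1"
          moreover have "?h = Suc (length xs)" unfolding xs by simp
          ultimately have "2 \<le> ?h" by linarith
          then have ab: "?a < ?b" using abh by linarith
          have a0: "0 < ?a" using frame_nonempty[of "even_of l"] by blast
          \<comment> \<open>the frame ends with the greatest entry of \<open>\<gamma>\<close>, which in \<open>compl ?O\<close> lies beyond the first summand\<close>
          have "\<gamma> ! (?a - 1) = ?n" using nth1[of "?a - 1"] last_frame(2)[of "even_of l"] a0 len by linarith
          then have "compl ?O ! (?a - 1) = ?b" using nth2[of "?a - 1"] ab a0 len' by linarith
          moreover have a1: "?a - 1 < ?b" using ab a0 by linarith
          ultimately have "?b + 1 - ?O ! (?a - 1) = ?b" using nth_compl by metis
          moreover have "?O ! (?a - 1) \<le> ?b" using is_permD[OF Ope nth_mem[OF a1]] by blast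
          ultimately have "?O ! (?a - 1) = 1" by linarith
          have "\<not> ?a - 1 < ?h"
          proof
            assume lt: "?a - 1 < ?h"
            then have "?O ! (?a - 1) = ?f ! (?a - 1) + length (odd_of l2)"
              unfolding O by (rule nth_skew)
            moreover have "1 \<le> ?f ! (?a - 1)" by (rule frame_even_of_positive[OF lt])
            moreover have "0 < length (odd_of l2)" using False by simp
            ultimately show False using \<open>?O ! (?a - 1) = 1\<close> by linarith
          qed
          then have ha: "?h < ?a" using a0 by linarith
          \<comment> \<open>the first summand ends with the least entry of \<open>compl ?O\<close>, which is too small for the shorter frame\<close>
          have "?h - 1 < ?h" unfolding xs by simp
          then have "?O ! (?h - 1) = ?f ! (?h - 1) + length (odd_of l2)"
            unfolding O by (rule nth_skew)
          then have "?O ! (?h - 1) = ?b" using last_frame(2)[of "even_of l1"] b by linarith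
          moreover have hb: "?h - 1 < ?b" "?h - 1 < ?a" using ha ab by linarith+
          ultimately have "compl ?O ! (?h - 1) = 1" using nth_compl[OF hb(1)] by linarith
          then have "\<gamma> ! (?h - 1) = 1 + (?n - ?b)" using nth2[OF hb(1)] by linarith
          moreover have "\<gamma> ! (?h - 1) = frame (even_of l) ! (?h - 1) + (?n - ?a)" by (rule nth1[OF hb(2)])
          moreover have "1 \<le> frame (even_of l) ! (?h - 1)"
            using ha by (intro frame_even_of_positive) linarith
          ultimately show False using ab len len' by linarith
        qed
        then have l1: "even_of l1 = Anti" by (rule frame_length_one)
        have ab: "?a = ?b" using abh h1 by linarith
        then have nab: "length (odd_of r) = length (lead (even_of r'))" using len len' by linarith
        have "map ((+) (length (odd_of r))) (frame (even_of l)) @ odd_of r =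
              map ((+) (length (odd_of r))) (compl ?O) @ lead (even_of r')"
          using trans[OF g[symmetric] g'] unfolding skew_def nab .
        then have "map ((+) (length (odd_of r))) (frame (even_of l)) = map ((+) (length (odd_of r))) (compl ?O)"
          and rl: "odd_of r = lead (even_of r')" using append_eq_append_conv[OF disjI2[OF nab]] by blast+
        then have fc: "frame (even_of l) = compl ?O"
          using inj_map_eq_map[of "(+) (length (odd_of r))"] by simp
        have "even_of l \<noteq> Anti"
        proof
          assume "even_of l = Anti"
          then have "?a = 1" by simp
          then have "length (odd_of l2) = 0" using b h1 ab by linarith
          then show False using False by simp
        qed
        then obtain p where p: "even_of l = Perm p" by (cases "even_of l") auto
        have "?O = compl (frame (Perm p))" using compl_compl[OF Ope] fc p by simp
        then have "skew [1] (odd_of l2) = skew [1] (skew p [1])"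
          using O l1 compl_frame[OF even_of_perm[OF p]] by simp
        then have "odd_of l2 = skew p [1]" by (simp add: skew_one)
        then obtain u where u: "odd_of u = p" using odd_of_eq_trail by blast
        have "length p < ?n" using len p by simp
        then have pJ: "Perm p \<in> janus" using less.hyps[of p l u] p u by simp
        have "even_of r' \<in> janus"
        proof (cases "even_of r'")
          case (Perm y)
          then obtain w where w: "odd_of w = y" using odd_of_eq_lead[of r y] rl by auto
          have "length y < ?n" using len' Perm by simp
          then show ?thesis using less.hyps[of y r' w] Perm w by simp
        qed (simp add: janus.anti)
        then have "Perm (skew (frame (Perm p)) (lead (even_of r'))) \<in> janus" using janus.hook pJ by blast
        then show ?thesis using g p rl by simp
      qed
    qed
  qed
qed

text \<open>
  For the second rule, $1 \oplus c(\gamma_1) \oplus 1$ is the complement of the odd thread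
  $1 \ominus \gamma_1 \ominus 1$.
\<close>
lemma threads_if_janus:
  assumes "g \<in> janus"
  shows "(\<exists>t. even_of t = g) \<and> (g = Anti \<or> (\<exists>t. g = Perm (odd_of t)))"
  using assms
proof induction
  case anti
  then show ?case by (auto intro: exI[of _ Leaf])
next
  case (lead g)
  then obtain t where "even_of t = g" by blast
  then have "even_of (Node Leaf t) = Perm (lead g)" by (simp add: compl_def)
  moreover have "\<exists>t. odd_of t = lead g"
  proof (cases g)
    case Anti
    then show ?thesis by (intro exI[of _ Leaf]) simp
  next
    case (Perm p)
    then obtain u where "odd_of u = p" using lead by auto
    then show ?thesis using Perm by (intro exI[of _ "Node Leaf u"]) simp
  qed
  ultimately show ?case by metis
next
  case (hook p g)
  obtain l where l: "even_of l = Perm p" using hook by blast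
  obtain u where u: "odd_of u = p" using hook by auto
  obtain r where r: "even_of r = g" using hook by blast
  have p: "is_perm p" by (rule even_of_perm[OF l])
  have "odd_of (Node Leaf Leaf) = [1]" by simp
  then obtain w1 where "odd_of w1 = skew p [1]" using odd_of_skew[of u "Node Leaf Leaf"] u by metis
  then have w: "odd_of (Node Leaf w1) = compl (frame (Perm p))" using compl_frame[OF p] by simp
  have "is_perm (frame (Perm p))" using is_perm_frame p by blast
  then have "compl (odd_of (Node Leaf w1)) = frame (Perm p)" unfolding w by (rule compl_compl)
  then have 1: "even_of (Node (Node Leaf w1) r) = Perm (skew (frame (Perm p)) (lead g))" using r by simp
  have "\<exists>v. odd_of v = lead g"
  proof (cases g)
    case Anti
    then show ?thesis by (intro exI[of _ Leaf]) simp
  next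
    case (Perm y)
    then obtain v where "odd_of v = y" using hook by auto
    then show ?thesis using Perm by (intro exI[of _ "Node Leaf v"]) simp
  qed
  then obtain v where "odd_of v = lead g" ..
  then have "odd_of (Node l v) = skew (frame (Perm p)) (lead g)" using l by simp
  then show ?case using 1 by metis
qed

lemma Janus_threads_eq: "Janus_threads = janus"
proof
  show "Janus_threads \<subseteq> janus"
    unfolding Janus_threads_def thread_sets using janus_if_threads janus.anti by auto
  show "janus \<subseteq> Janus_threads"
    unfolding Janus_threads_def thread_sets using threads_if_janus by (auto simp: image_iff)
qed

lemma janus_perm: "Perm p \<in> janus \<Longrightarrow> is_perm p"
  using threads_if_janus even_of_perm by blast


section \<open>The direct map along the generators\<close>

fun invert :: "step \<Rightarrow> step" where
  "invert U = D" | "invert D = U" | "invert L = L"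

definition turns :: "step list \<Rightarrow> nat" where
  "turns w = length (filter (\<lambda>s. s \<noteq> L) w)"

lemma swap_odd_parity: "even (j + k) \<Longrightarrow> swap_odd j w = swap_odd k w"
proof (induction w arbitrary: j k)
  case (Cons s w)
  have "even (j + 1 + (k + 1))" "odd j = odd k" using Cons.prems by presburger+
  then show ?case using Cons.IH[of "j + 1" "k + 1"] Cons.IH[OF Cons.prems] by (cases s) auto
qed simp

lemma swap_odd_append: "swap_odd k (u @ w) = swap_odd k u @ swap_odd (k + turns u) w"
proof (induction u arbitrary: k)
  case (Cons s u)
  then show ?case by (cases s) (simp_all add: turns_def)
qed (simp add: turns_def)

lemma swap_odd_invert: "swap_odd k (map invert w) = swap_odd (Suc k) w"
proof (induction w arbitrary: k)
  case (Cons s w)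
  then show ?case by (cases s) simp_all
qed simp

lemma turns_swap_odd: "turns (swap_odd k w) = turns w"
proof (induction w arbitrary: k)
  case (Cons s w)
  then show ?case by (cases s) (simp_all add: turns_def)
qed (simp add: turns_def)

lemma turns_invert: "turns (map invert w) = turns w"
proof (induction w)
  case (Cons s w)
  then show ?case by (cases s) (simp_all add: turns_def)
qed (simp add: turns_def)

lemma length_swap_odd: "length (swap_odd k w) = length w"
proof (induction w arbitrary: k)
  case (Cons s w)
  then show ?case by (cases s) simp_all
qed simp

lemma length_consecutive_steps: "length (consecutive_steps xs) = length xs - 1"
  by (induction xs rule: consecutive_steps.induct) auto

lemma consecutive_steps_Cons:
  "xs \<noteq> [] \<Longrightarrow> consecutive_steps (a # xs) = step_between a (hd xs) # consecutive_steps xs"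
  by (cases xs) auto

lemma consecutive_steps_append:
  "xs \<noteq> [] \<Longrightarrow> ys \<noteq> [] \<Longrightarrow>
   consecutive_steps (xs @ ys) = consecutive_steps xs @ step_between (last xs) (hd ys) # consecutive_steps ys"
proof (induction xs rule: consecutive_steps.induct)
  case ("2_2" a)
  then show ?case by (simp add: consecutive_steps_Cons)
qed auto

lemma consecutive_steps_shift: "consecutive_steps (map ((+) k) xs) = consecutive_steps xs"
  by (induction xs rule: consecutive_steps.induct) (auto simp: step_between_def)

text \<open>
  Distinctness excludes equal neighbours, which count as a descent in both words.
\<close>
lemma consecutive_steps_reflect:
  "distinct xs \<Longrightarrow> \<forall>x\<in>set xs. x \<le> c \<Longrightarrow>
   consecutive_steps (map (\<lambda>x. c - x) xs) = map invert (consecutive_steps xs)"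
  by (induction xs rule: consecutive_steps.induct) (auto simp: step_between_def)

text \<open>
  For a permutation this is $|g| + 1, g, 0$.  Written in this way it also covers \<open>Anti\<close>, whose word is
  the single entry 0, so that the direct map needs no exceptional cases.
\<close>
definition bounded_word :: "aperm \<Rightarrow> nat list" where
  "bounded_word g = lead g @ [0]"

lemma bounded_word_Perm: "bounded_word (Perm p) = (length p + 1) # p @ [0]"
  unfolding bounded_word_def by (simp add: skew_one)

lemma direct_K_eq: "direct_K g = swap_odd 1 (consecutive_steps (bounded_word g))"
proof (cases g)
  case Anti
  then show ?thesis by (simp add: bounded_word_def)
next
  case (Perm p)
  then show ?thesis unfolding bounded_word_Perm Perm
    by (cases "p = []") (simp_all add: step_between_def)
qed

lemma hd_bounded_word: "hd (bounded_word g) = length (lead g)"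
  unfolding bounded_word_def by (cases g) (auto simp: skew_one)

lemma bounded_word_lead: "bounded_word (Perm (lead g)) = (length (lead g) + 1) # bounded_word g"
  unfolding bounded_word_Perm by (simp add: bounded_word_def)

lemma direct_K_lead: "direct_K (Perm (lead g)) = L # direct_K g"
proof -
  have "bounded_word g \<noteq> []" unfolding bounded_word_def by simp
  then show ?thesis unfolding direct_K_eq bounded_word_lead
    by (simp add: consecutive_steps_Cons hd_bounded_word step_between_def)
qed

lemma frame_reflects_bounded_word:
  assumes "is_perm p"
  shows "frame (Perm p) = map (\<lambda>v. length p + 2 - v) (bounded_word (Perm p))"
proof -
  have "map Suc (compl p) = map (\<lambda>v. length p + 2 - v) p"
  proof -
    have "Suc (length p + 1 - v) = length p + 2 - v" if "v \<in> set p" for v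
      using is_permD[OF assms that] by linarith
    then show ?thesis unfolding compl_def by simp
  qed
  then show ?thesis unfolding bounded_word_Perm by simp
qed

text \<open>
  The block \<open>frame (Perm p)\<close> is a reflected copy of the bounded word of \<open>p\<close>; it is entered and
  left by descents of at least two.  The entering descent has number 1 and becomes \<open>U\<close>.
  Inside, the reflection inverts all letters and the numbering is shifted by one, and these
  two effects cancel.  If the number of letters other than \<open>L\<close> inside is even, the leaving
  descent has an even number and stays \<open>D\<close>, and the numbering of the rest is odd again.
\<close>
lemma direct_K_hook:
  assumes p: "is_perm p" and even: "even (turns (direct_K (Perm p)))"
  shows "direct_K (Perm (skew (frame (Perm p)) (lead g))) = U # direct_K (Perm p) @ D # direct_K g"
proof -
  let ?k = "length (lead g)" and ?m = "length p" and ?W = "consecutive_steps (bounded_word (Perm p))"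
  let ?f = "map ((+) ?k) (frame (Perm p))"
  have ne: "bounded_word g \<noteq> []" and nf: "frame (Perm p) \<noteq> []" unfolding bounded_word_def by simp_all
  have "distinct (bounded_word (Perm p))" "\<forall>x\<in>set (bounded_word (Perm p)). x \<le> ?m + 2"
    using p is_permD[OF p] unfolding bounded_word_Perm is_perm_def by fastforce+
  then have steps_f: "consecutive_steps ?f = map invert ?W"
    unfolding consecutive_steps_shift frame_reflects_bounded_word[OF p] by (rule consecutive_steps_reflect)
  have "bounded_word (Perm (skew (frame (Perm p)) (lead g))) = (?m + 2 + ?k + 1) # ?f @ bounded_word g"
    unfolding bounded_word_Perm by (simp add: skew_def bounded_word_def)
  moreover have "step_between (?m + 2 + ?k + 1) (hd ?f) = D" by (simp add: step_between_def)
  moreover have "step_between (last ?f) (hd (bounded_word g)) = D"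
    by (simp add: hd_bounded_word step_between_def)
  ultimately have "consecutive_steps (bounded_word (Perm (skew (frame (Perm p)) (lead g)))) =
      D # map invert ?W @ D # consecutive_steps (bounded_word g)"
    using ne nf steps_f by (simp add: consecutive_steps_Cons consecutive_steps_append hd_append del: frame.simps)
  then have "direct_K (Perm (skew (frame (Perm p)) (lead g))) =
      U # swap_odd 2 (map invert ?W) @ swap_odd (2 + turns ?W) (D # consecutive_steps (bounded_word g))"
    unfolding direct_K_eq by (simp add: swap_odd_append turns_invert numeral_2_eq_2)
  also have "swap_odd 2 (map invert ?W) = direct_K (Perm p)"
    unfolding direct_K_eq swap_odd_invert by (intro swap_odd_parity) simp
  also have "swap_odd (2 + turns ?W) (D # consecutive_steps (bounded_word g)) = D # direct_K g"
  proof -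
    have "even (turns ?W)" using even unfolding direct_K_eq turns_swap_odd .
    then show ?thesis unfolding direct_K_eq by (auto intro: swap_odd_parity)
  qed
  finally show ?thesis .
qed

lemma length_direct_K: "int (length (direct_K g)) = alength g + 1"
  unfolding direct_K_eq length_swap_odd length_consecutive_steps bounded_word_def by (cases g) auto

section \<open>Peakless Motzkin paths\<close>

lemma height_simps [simp]: "height [] = 0" "height (s # w) = rise s + height w" "height (u @ w) = height u + height w"
  unfolding height_def by simp_all

lemma even_turns_height: "even (int (turns w) + height w)"
proof (induction w)
  case (Cons s w)
  then show ?case by (cases s) (simp_all add: turns_def)
qed (simp add: turns_def)

lemma Motzkin_path_take: "Motzkin_path w \<Longrightarrow> 0 \<le> height (take k w)"
  unfolding Motzkin_path_def by (cases "k \<le> length w") auto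

lemma Motzkin_pathI: "height w = 0 \<Longrightarrow> (\<And>k. 0 \<le> height (take k w)) \<Longrightarrow> Motzkin_path w"
  unfolding Motzkin_path_def by simp

lemma even_turns_Motzkin: "Motzkin_path w \<Longrightarrow> even (turns w)"
  using even_turns_height[of w] unfolding Motzkin_path_def by simp

lemma peakless_iff: "peakless w \<longleftrightarrow> successively (\<lambda>a b. \<not> (a = U \<and> b = D)) w"
proof (induction w rule: induct_list012)
  case (3 x y zs)
  have "peakless (x # y # zs) \<longleftrightarrow> \<not> (x = U \<and> y = D) \<and> peakless (y # zs)"
    unfolding peakless_def by (auto simp: nth_Cons split: nat.splits)
  then show ?case using 3 by simp
qed (auto simp: peakless_def)

definition peakless_Motzkin :: "step list \<Rightarrow> bool" where
  "peakless_Motzkin w \<longleftrightarrow> Motzkin_path w \<and> peakless w"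

lemma Motzkin_path_arch:
  assumes u: "Motzkin_path u"
  shows "Motzkin_path (U # u @ D # w) \<longleftrightarrow> Motzkin_path w"
proof
  assume uw: "Motzkin_path (U # u @ D # w)"
  have hu: "height u = 0" using u unfolding Motzkin_path_def by simp
  show "Motzkin_path w"
  proof (rule Motzkin_pathI)
    show "height w = 0" using uw hu unfolding Motzkin_path_def by simp
    show "0 \<le> height (take k w)" for k
      using Motzkin_path_take[OF uw, of "Suc (length u + Suc k)"] hu by simp
  qed
next
  assume w: "Motzkin_path w"
  have hu: "height u = 0" using u unfolding Motzkin_path_def by simp
  show "Motzkin_path (U # u @ D # w)"
  proof (rule Motzkin_pathI)
    show "height (U # u @ D # w) = 0" using w hu unfolding Motzkin_path_def by simp
    show "0 \<le> height (take k (U # u @ D # w))" for k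
    proof (cases k)
      case (Suc j)
      then show ?thesis
        using Motzkin_path_take[OF u, of j] Motzkin_path_take[OF w, of "j - length u - 1"] hu
        by (cases "j - length u") (auto simp: take_Cons')
    qed simp
  qed
qed

text \<open>
  A Motzkin path neither starts with \<open>D\<close> nor ends with \<open>U\<close>, so a peak can involve the outer
  steps only if the path between them is empty.
\<close>
lemma peakless_arch:
  assumes u: "Motzkin_path u"
  shows "peakless (U # u @ D # w) \<longleftrightarrow> u \<noteq> [] \<and> peakless u \<and> peakless w"
proof (cases "u = []")
  case True
  then show ?thesis by (simp add: peakless_iff)
next
  case False
  have "hd u \<noteq> D"
    using Motzkin_path_take[OF u, of 1] False by (cases u) auto
  moreover have "last u \<noteq> U"
  proof
    assume "last u = U"
    then have "u = butlast u @ [U]" using append_butlast_last_id[OF False] by simp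
    then have "height u = height (butlast u) + 1" by (metis height_simps rise.simps(1) add_0_right)
    moreover have "0 \<le> height (butlast u)"
      using Motzkin_path_take[OF u, of "length u - 1"] by (simp add: butlast_conv_take)
    ultimately show False using u unfolding Motzkin_path_def by simp
  qed
  ultimately show ?thesis using False
    by (auto simp: peakless_iff successively_Cons successively_append_iff hd_append)
qed

lemma Motzkin_path_L: "Motzkin_path (L # w) \<longleftrightarrow> Motzkin_path w"
proof
  assume w: "Motzkin_path (L # w)"
  show "Motzkin_path w"
    using w Motzkin_path_take[OF w, of "Suc k" for k] by (intro Motzkin_pathI) (auto simp: Motzkin_path_def)
next
  assume w: "Motzkin_path w"
  have "0 \<le> height (take k (L # w))" for k
    using Motzkin_path_take[OF w, of "k - 1"] by (cases k) auto
  then show "Motzkin_path (L # w)"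
    using w by (intro Motzkin_pathI) (auto simp: Motzkin_path_def)
qed

lemma peakless_Motzkin_simps:
  "peakless_Motzkin []"
  "peakless_Motzkin (L # w) \<longleftrightarrow> peakless_Motzkin w"
  "Motzkin_path u \<Longrightarrow> peakless_Motzkin (U # u @ D # w) \<longleftrightarrow> u \<noteq> [] \<and> peakless_Motzkin u \<and> peakless_Motzkin w"
  unfolding peakless_Motzkin_def Motzkin_path_L Motzkin_path_arch peakless_arch
  by (auto simp: peakless_iff Motzkin_path_def successively_Cons)

lemma first_passage:
  assumes "height w < 0"
  shows "\<exists>u v. w = u @ D # v \<and> Motzkin_path u"
proof -
  define k where "k = (LEAST k. height (take k w) < 0)"
  have ex: "height (take (length w) w) < 0" using assms by simp
  have k: "height (take k w) < 0" unfolding k_def by (rule LeastI[of _ "length w"]) (rule ex)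
  have min: "0 \<le> height (take j w)" if "j < k" for j
    using not_less_Least[of j "\<lambda>k. height (take k w) < 0"] that unfolding k_def by simp
  have "k \<le> length w" unfolding k_def by (rule Least_le) (rule ex)
  moreover have "k \<noteq> 0" using k by (intro notI) simp
  ultimately obtain j where j: "k = Suc j" "j < length w" by (cases k) auto
  then have "take k w = take j w @ [w ! j]" by (simp add: take_Suc_conv_app_nth)
  then have h: "height (take j w) + rise (w ! j) < 0" using k by simp
  then have "w ! j = D" "height (take j w) = 0" using min[of j] j by (cases "w ! j"; simp)+
  then have "Motzkin_path (take j w)" using min j by (intro Motzkin_pathI) (auto simp: min_def)
  moreover have "w = take j w @ D # drop (Suc j) w"
    using id_take_nth_drop[OF j(2)] \<open>w ! j = D\<close> by simp
  ultimately show ?thesis by blast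
qed

lemma peakless_Motzkin_cases:
  assumes "peakless_Motzkin w"
  obtains "w = []" | w' where "w = L # w'" "peakless_Motzkin w'"
  | u v where "w = U # u @ D # v" "peakless_Motzkin u" "u \<noteq> []" "peakless_Motzkin v"
proof (cases w)
  case (Cons s w')
  show ?thesis
  proof (cases s)
    case U
    have "height w = 0" using assms unfolding peakless_Motzkin_def Motzkin_path_def by simp
    then have "height w' < 0" using Cons U by simp
    then obtain u v where uv: "w' = u @ D # v" "Motzkin_path u" using first_passage by blast
    then have "u \<noteq> [] \<and> peakless_Motzkin u \<and> peakless_Motzkin v"
      using assms Cons U peakless_Motzkin_simps(3) by simp
    then show ?thesis using that(3) Cons U uv by blast
  next
    case D
    have "0 \<le> height (take 1 w)" using assms Motzkin_path_take unfolding peakless_Motzkin_def by blast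
    then show ?thesis using Cons D by simp
  next
    case L
    then show ?thesis using that(2) Cons assms peakless_Motzkin_simps(2) by simp
  qed
qed (use that in simp)

lemma arch_unique:
  assumes "u @ D # w = u' @ D # w'" "Motzkin_path u" "Motzkin_path u'"
  shows "u = u' \<and> w = w'"
proof -
  have no: False if "u = v @ D # x" "Motzkin_path u" "Motzkin_path v" for u v x
  proof -
    have "height (take (Suc (length v)) u) = -1" using that unfolding Motzkin_path_def by simp
    then show False using Motzkin_path_take[OF that(2), of "Suc (length v)"] by simp
  qed
  obtain x where "u = u' @ x \<and> x @ D # w = D # w' \<or> u @ x = u' \<and> D # w = x @ D # w'"
    using assms(1) by (auto simp: append_eq_append_conv2)
  then show ?thesis
  proof
    assume x: "u = u' @ x \<and> x @ D # w = D # w'"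
    then show ?thesis using no[of u u' "tl x"] assms by (cases x) auto
  next
    assume x: "u @ x = u' \<and> D # w = x @ D # w'"
    then show ?thesis using no[of u' u "tl x"] assms by (cases x) auto
  qed
qed

section \<open>The direct map is the recursive bijection\<close>

lemma peakless_Motzkin_direct_K: "g \<in> janus \<Longrightarrow> peakless_Motzkin (direct_K g)"
proof (induction rule: janus.induct)
  case anti
  then show ?case by (simp add: peakless_Motzkin_simps)
next
  case (lead g)
  then show ?case unfolding direct_K_lead by (simp add: peakless_Motzkin_simps)
next
  case (hook p g)
  have M: "Motzkin_path (direct_K (Perm p))" using hook unfolding peakless_Motzkin_def by simp
  have "direct_K (Perm p) \<noteq> []" using length_direct_K[of "Perm p"] by (intro notI) simp
  then show ?case
    unfolding direct_K_hook[OF janus_perm[OF hook.hyps(1)] even_turns_Motzkin[OF M]]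
    using hook M peakless_Motzkin_simps(3) by simp
qed

lemma direct_K_janus_hook:
  assumes "Perm p \<in> janus"
  shows "direct_K (Perm (skew (frame (Perm p)) (lead g))) = U # direct_K (Perm p) @ D # direct_K g"
  using direct_K_hook[OF janus_perm[OF assms] even_turns_Motzkin] peakless_Motzkin_direct_K[OF assms]
  unfolding peakless_Motzkin_def by simp

lemma direct_K_inj: "g \<in> janus \<Longrightarrow> g' \<in> janus \<Longrightarrow> direct_K g = direct_K g' \<Longrightarrow> g = g'"
proof (induction arbitrary: g' rule: janus.induct)
  case anti
  from anti(1) show ?case
    by cases (use anti(2) in \<open>auto simp: direct_K_lead direct_K_janus_hook simp del: direct_K.simps(2) lead.simps frame.simps\<close>)
next
  case (lead g)
  from lead.prems(1) show ?case
    by cases (use lead in \<open>auto simp: direct_K_lead direct_K_janus_hook simp del: direct_K.simps(2) lead.simps frame.simps\<close>)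
next
  case (hook p g)
  note eq = hook.prems(2)[unfolded direct_K_janus_hook[OF hook.hyps(1)]]
  from hook.prems(1) show ?case
  proof cases
    case anti
    then show ?thesis using eq by simp
  next
    case (lead h)
    then show ?thesis using eq by (simp add: direct_K_lead del: direct_K.simps(2) lead.simps frame.simps)
  next
    case (hook q h)
    have "direct_K (Perm p) @ D # direct_K g = direct_K (Perm q) @ D # direct_K h"
      using eq unfolding hook(1) direct_K_janus_hook[OF hook(2)] by simp
    then have "direct_K (Perm p) = direct_K (Perm q) \<and> direct_K g = direct_K h"
      using arch_unique peakless_Motzkin_direct_K hook(2) \<open>Perm p \<in> janus\<close> unfolding peakless_Motzkin_def by blast
    then have "Perm p = Perm q" "g = h"
      using hook.IH(1)[OF hook(2)] hook.IH(2)[OF hook(3)] by auto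
    then show ?thesis using hook(1) by simp
  qed
qed

lemma direct_K_surj: "peakless_Motzkin w \<Longrightarrow> \<exists>g\<in>janus. direct_K g = w"
proof (induction "length w" arbitrary: w rule: less_induct)
  case less
  from less.prems show ?case
  proof (cases rule: peakless_Motzkin_cases)
    case 1
    then show ?thesis by (intro bexI[of _ Anti] janus.anti) simp
  next
    case (2 w')
    then obtain g where "g \<in> janus" "direct_K g = w'" using less.hyps[of w'] by auto
    then show ?thesis using 2 by (intro bexI[of _ "Perm (lead g)"] janus.lead) (simp add: direct_K_lead del: direct_K.simps(2))
  next
    case (3 u v)
    then obtain g h where gh: "g \<in> janus" "direct_K g = u" "h \<in> janus" "direct_K h = v"
      using less.hyps[of u] less.hyps[of v] by auto
    then obtain p where "g = Perm p" using 3 by (cases g) auto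
    then show ?thesis using 3 gh direct_K_janus_hook[of p h]
      by (intro bexI[of _ "Perm (skew (frame (Perm p)) (lead h))"] janus.hook) simp_all
  qed
qed

lemma one_ssum: "one_perm \<ominus> g = Perm (lead g)"
  by (cases g) (simp_all add: skew_def)

lemma hook_sums: "(one_perm \<oplus> complement (Perm p) \<oplus> one_perm) \<ominus> one_perm \<ominus> g
    = Perm (skew (frame (Perm p)) (lead g))"
proof -
  have "one_perm \<oplus> complement (Perm p) \<oplus> one_perm = Perm (frame (Perm p))"
    by (simp add: compl_def)
  then show ?thesis unfolding one_ssum by (simp add: skew_def del: frame.simps lead.simps complement.simps)
qed

lemma is_recursive_K_direct_K: "is_recursive_K (restrict direct_K janus)"
proof -
  let ?F = "restrict direct_K janus"
  have "bij_betw ?F (JT n) (UD (nat (n + 1)))" if "-1 \<le> n" for n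
  proof (rule bij_betw_imageI)
    show "inj_on ?F (JT n)"
      using direct_K_inj unfolding inj_on_def JT_def Janus_threads_eq by simp
    show "?F ` JT n = UD (nat (n + 1))"
    proof (intro set_eqI iffI)
      fix w assume "w \<in> ?F ` JT n"
      then obtain g where "g \<in> janus" "alength g = n" "w = direct_K g" unfolding JT_def Janus_threads_eq by auto
      then show "w \<in> UD (nat (n + 1))"
        using peakless_Motzkin_direct_K[of g] length_direct_K[of g] unfolding UD_def peakless_Motzkin_def by auto
    next
      fix w assume w: "w \<in> UD (nat (n + 1))"
      then have "peakless_Motzkin w" unfolding UD_def peakless_Motzkin_def by simp
      then obtain g where g: "g \<in> janus" "direct_K g = w" using direct_K_surj by blast
      then have "alength g = n" using length_direct_K[of g] w that unfolding UD_def by simp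
      then have "g \<in> JT n" using g unfolding JT_def Janus_threads_eq by simp
      then show "w \<in> ?F ` JT n" using g by force
    qed
  qed
  moreover have "?F (one_perm \<ominus> g) = [L] @ ?F g" if "g \<in> janus" for g
    unfolding one_ssum using that janus.lead[OF that] by (simp add: direct_K_lead del: direct_K.simps(2))
  moreover have "?F ((one_perm \<oplus> complement g1 \<oplus> one_perm) \<ominus> one_perm \<ominus> g2) = [U] @ ?F g1 @ [D] @ ?F g2"
    if "g1 \<in> janus" "g2 \<in> janus" "0 \<le> alength g1" for g1 g2
  proof -
    obtain p where p: "g1 = Perm p" using \<open>0 \<le> alength g1\<close> by (cases g1) auto
    have "Perm p \<in> janus" using \<open>g1 \<in> janus\<close> p by simp
    then show ?thesis unfolding p hook_sums
      using \<open>g2 \<in> janus\<close> janus.hook[of p g2] direct_K_janus_hook[of p g2]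
      by (simp del: direct_K.simps(2) frame.simps)
  qed
  moreover have "?F empty_perm = [L]"
    using janus.lead[OF janus.anti] by simp
  ultimately show ?thesis
    unfolding is_recursive_K_def Janus_threads_eq using janus.anti by simp
qed

lemma is_recursive_K_eq:
  assumes F: "is_recursive_K F" and g: "g \<in> janus" shows "F g = direct_K g"
  using g
proof (induction rule: janus.induct)
  case anti
  then show ?case using F unfolding is_recursive_K_def by simp
next
  case (lead g)
  have "F (one_perm \<ominus> g) = [L] @ F g"
    using F lead(1) unfolding is_recursive_K_def Janus_threads_eq by blast
  then show ?case using lead(2) unfolding one_ssum direct_K_lead by simp
next
  case (hook p g)
  have "F ((one_perm \<oplus> complement (Perm p) \<oplus> one_perm) \<ominus> one_perm \<ominus> g) = [U] @ F (Perm p) @ [D] @ F g"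
    using F hook.hyps unfolding is_recursive_K_def Janus_threads_eq by (simp only: alength.simps of_nat_0_le_iff)
  then show ?case using hook.IH unfolding hook_sums direct_K_janus_hook[OF hook.hyps(1)] by simp
qed

theorem theorem6p8:
  fixes \<gamma> :: aperm
  assumes "\<gamma> \<in> Janus_threads"
  shows "direct_K \<gamma> = recursive_K \<gamma>"
proof -
  have "recursive_K = restrict direct_K janus"
    unfolding recursive_K_def
  proof (rule the_equality, rule is_recursive_K_direct_K)
    fix F assume F: "is_recursive_K F"
    show "F = restrict direct_K janus"
    proof (rule extensionalityI[where A = janus])
      show "F \<in> extensional janus" using F unfolding is_recursive_K_def Janus_threads_eq by simp
    qed (simp_all add: is_recursive_K_eq[OF F])
  qed
  then have "recursive_K \<gamma> = restrict direct_K janus \<gamma>" by (rule fun_cong)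
  then show ?thesis using assms unfolding Janus_threads_eq by simp
qed

end
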